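(* Let $D_1,D_2\subset\mathbb R$ be intervals containing $0$, and let $\alpha:D_1\to\mathbb R$, $\beta:D_2\to\mathbb R$ be smooth functions with $\alpha(0)=0$. Let $$V_{-0}(x)=\begin{bmatrix} e^{-i\alpha(x)/2} & 0 \\ 0 & e^{i\alpha(x)/2} \end{bmatrix},$$ and let $U^X_+(x)=U^X_+(x,\lambda)$ and $U^Y_-(y)=U^Y_-(y,\lambda)$ satisfy $$(U^X_+)^{-1}\frac{\partial U^X_+}{\partial x}=\frac{i}{2}\lambda\begin{bmatrix} 0 & e^{-i\alpha(x)} \\ e^{i\alpha(x)} & 0 \end{bmatrix},\qquad (U^Y_-)^{-1}\frac{\partial U^Y_-}{\partial y}=-\frac{i}{2\lambda}\begin{bmatrix} 0 & e^{i\beta(y)} \\ e^{-i\beta(y)} & 0 \end{bmatrix},$$ with $U^X_+(0)=I$ and $U^Y_-(0)=I$. Let $D=D_1\times D_2$, and let $$(U^Y_-)^{-1}U^X_+V_{-0}=V_+(T_-)^{-1}$$ be the Birkhoff decomposition of the left-hand side, with $V_+(x,y)\in\Lambda^+SU(2)$ and $T_-(x,y)\in\Lambda^-_*SU(2)$. Then $$U=U^X_+V_{-0}T_-=U^Y_-V_+$$ satisfies $U(0,0;\lambda)=I$ for all $\lambda$, and there is a function $\phi(x,y)$ on $D$ with $$\phi(x,0)=\alpha(x)+\beta(0),\qquad \phi(0,y)=\beta(y)$$ such that $$\frac{\partial U}{\partial x}=\frac{i}{2}U\begin{bmatrix} -\phi_x & \lambda \\ \lambda & \phi_x \end{bmatrix},\qquad\frac{\partial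 U}{\partial y}=-\frac{i}{2\lambda}U\begin{bmatrix} 0 & e^{i\phi} \\ e^{-i\phi} & 0 \end{bmatrix}$$ on $D$.
   Context: $\mathbb R^*=\mathbb R\setminus\{0\}$, $\mathbb C^*=\mathbb C\setminus\{0\}$, $\sigma_3=\operatorname{diag}(1,-1)$. $\widetilde\Lambda SU(2)$ is the group of maps $g:\mathbb R^*\to SU(2)$ satisfying the twisting condition $g(-\lambda)=\sigma_3\,g(\lambda)\,\sigma_3^{-1}$ which extend to analytic maps $\mathbb C^*\to SL(2,\mathbb C)$. $\Lambda^+SU(2)$ (resp. $\Lambda^-SU(2)$) is the subgroup of those $g$ with expansion $g=g_0+\lambda g_1+\lambda^2g_2+\cdots$ (resp. $g=g_0+\lambda^{-1}g_1+\lambda^{-2}g_2+\cdots$); $\Lambda^\pm_*SU(2)$ is the subgroup of $\Lambda^\pm SU(2)$ with $g_0=I$. Known fact (Birkhoff decomposition; may be used): the multiplication maps $\Lambda^+_*SU(2)\times\Lambda^-SU(2)\to\widetilde\Lambda SU(2)$ and $\Lambda^-_*SU(2)\times\Lambda^+SU(2)\to\widetilde\Lambda SU(2)$ are diffeomorphisms; taking inverses, every $g\in\widetilde\Lambda SU(2)$ factors uniquely as $g=g_+g_-$ with $g_+\in\Lambda^+SU(2)$, $g_-\in\Lambda^-_*SU(2)$, the factors depending smoothly on $g$. *)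

theory Defs
  imports "HOL-Analysis.Analysis"
begin

definition mat2 :: "complex \<Rightarrow> complex \<Rightarrow> complex \<Rightarrow> complex \<Rightarrow> complex^2^2" where
  "mat2 a b c d = vector [vector [a, b], vector [c, d]]"

definition cscale :: "complex \<Rightarrow> complex^2^2 \<Rightarrow> complex^2^2" (infixr \<open>*m\<close> 75) where
  "c *m A = (\<chi> i j. c * A $ i $ j)"

definition conj_transpose :: "complex^2^2 \<Rightarrow> complex^2^2" where
  "conj_transpose A = (\<chi> i j. cnj (A $ j $ i))"

definition SL2 :: "(complex^2^2) set" where
  "SL2 = {A. det A = 1}"

definition SU2 :: "(complex^2^2) set" where
  "SU2 = {A. conj_transpose A ** A = mat 1 \<and> det A = 1}"

definition sigma3 :: "complex^2^2" where
  "sigma3 = mat2 1 0 0 (-1)"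

text \<open>
  Loops are maps on the nonzero reals. They are represented by functions on all of \<open>real\<close>
  whose value at 0 is irrelevant: every condition below is restricted to nonzero arguments.
\<close>

definition Loop_SU2 :: "(real \<Rightarrow> complex^2^2) set" where
  "Loop_SU2 = {g.
     (\<forall>l. l \<noteq> 0 \<longrightarrow> g l \<in> SU2) \<and>
     (\<forall>l. l \<noteq> 0 \<longrightarrow> g (-l) = sigma3 ** g l ** matrix_inv sigma3) \<and>
     (\<exists>G :: complex \<Rightarrow> complex^2^2.
        (\<forall>i j. (\<lambda>z. G z $ i $ j) analytic_on (- {0})) \<and>
        (\<forall>z. z \<noteq> 0 \<longrightarrow> G z \<in> SL2) \<and>
        (\<forall>l. l \<noteq> 0 \<longrightarrow> G (of_real l) = g l))}"

definition Loop_plus :: "(real \<Rightarrow> complex^2^2) set" where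
  "Loop_plus = {g \<in> Loop_SU2. \<exists>a :: nat \<Rightarrow> complex^2^2.
     \<forall>l. l \<noteq> 0 \<longrightarrow> (\<lambda>n. l ^ n *\<^sub>R a n) sums g l}"

definition Loop_minus_star :: "(real \<Rightarrow> complex^2^2) set" where
  "Loop_minus_star = {g \<in> Loop_SU2. \<exists>a :: nat \<Rightarrow> complex^2^2.
     a 0 = mat 1 \<and> (\<forall>l. l \<noteq> 0 \<longrightarrow> (\<lambda>n. inverse l ^ n *\<^sub>R a n) sums g l)}"

text \<open>
  Smoothness on an arbitrary interval: \<open>d n\<close> is the \<open>n\<close>-th derivative, one-sided at those
  endpoints that belong to the interval.
\<close>

definition smooth_on :: "real set \<Rightarrow> (real \<Rightarrow> real) \<Rightarrow> bool" where
  "smooth_on D f \<longleftrightarrow> (\<exists>d :: nat \<Rightarrow> real \<Rightarrow> real.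
     (\<forall>x\<in>D. d 0 x = f x) \<and>
     (\<forall>n. \<forall>x\<in>D. (d n has_real_derivative d (Suc n) x) (at x within D)))"

text \<open>
  The logarithmic derivative \<open>W\<^sup>-\<^sup>1 W'\<close> at \<open>x\<close> equals \<open>M\<close>. Invertibility is demanded because
  \<open>matrix_inv\<close> is arbitrary on singular matrices.
\<close>

definition has_left_log_derivative ::
  "(real \<Rightarrow> complex^2^2) \<Rightarrow> complex^2^2 \<Rightarrow> real \<Rightarrow> real set \<Rightarrow> bool" where
  "has_left_log_derivative W M x D \<longleftrightarrow> invertible (W x) \<and>
     (\<exists>W'. (W has_vector_derivative W') (at x within D) \<and> matrix_inv (W x) ** W' = M)"

end

theory Submission
  imports Defs "HOL-Complex_Analysis.Conformal_Mappings"
begin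

text \<open>
  The loops \<open>V\<close> and \<open>T\<close> are \<open>P(\<lambda>)\<close> and \<open>Q(1/\<lambda>)\<close> for entire matrix functions \<open>P\<close>, \<open>Q\<close> of
  determinant 1 with \<open>Q(0) = 1\<close>. On an
  annulus \<open>F Q(1/\<lambda>) = P(\<lambda>)\<close>, where \<open>F = U\<^sub>Y\<^sup>-\<^sup>1 U\<^sub>X V\<^sub>0\<close> is differentiable in \<open>x\<close> and \<open>y\<close> uniformly
  in \<open>\<lambda>\<close> because \<open>U\<^sub>X\<close> and \<open>U\<^sub>Y\<close> are power series in \<open>\<lambda>\<close> and \<open>1/\<lambda>\<close>; a perturbation argument based on
  the maximum principle transfers this to \<open>P\<close> and \<open>Q\<close> and computes the derivatives. Then
  \<open>U\<^sup>-\<^sup>1 U\<^sub>x\<close> is the part of \<open>T\<^sup>-\<^sup>1 (\<lambda> M\<^sub>1 + M\<^sub>0) T\<close> of degree at least 0, and \<open>U\<^sup>-\<^sup>1 U\<^sub>y\<close> is the part of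
  negative degree of a conjugate by \<open>V\<close>, which only involves the diagonal matrix \<open>P(0)\<close>. Finally
  \<open>\<phi> = \<psi> + \<beta>\<close>, where \<open>exp(-i \<psi>/2)\<close> is the upper left entry of \<open>P(0)\<close> and \<open>\<psi>\<close> is continuous in \<open>x\<close>.
\<close>

subsection \<open>Two by two complex matrices\<close>

text \<open>The Birkhoff factors are given separately for each \<open>(x, y)\<close>, so their
  dependence on \<open>x\<close> and \<open>y\<close> has to be proved; this is the purpose of the
  perturbation argument. It compares functions of \<lambda> in the sup norm on complex domains,
  while the data are prescribed for real \<lambda>; power series, a series solution of the
  differential equations and the identity theorem make the transition. Uniformity needs compactness,
  and \<open>D1\<close>, \<open>D2\<close> are arbitrary intervals, so each point is placed,
  together with 0, in a compact subinterval that is a neighbourhood of the point in the whole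
  interval. Each direction uses the factorization whose left factor is constant:
  \<open>U = UY V\<close> in \<open>x\<close> and \<open>U = UX V0 T\<close> in \<open>y\<close>.
  Hence only the derivatives of \<open>V\<close> in \<open>x\<close> and of \<open>T\<close> in
  \<open>y\<close> matter. The phase is lifted along \<open>x\<close> for each fixed
  \<open>y\<close>, because \<phi> is differentiated in \<open>x\<close> only and enters the
  \<open>y\<close> equation through its exponential.\<close>

type_synonym cmat = "complex^2^2"

lemma mat2_nth [simp]:
  "mat2 a b c d $ 1 $ 1 = a" "mat2 a b c d $ 1 $ 2 = b"
  "mat2 a b c d $ 2 $ 1 = c" "mat2 a b c d $ 2 $ 2 = d"
  by (simp_all add: mat2_def)

lemma cmat_eq_iff:
  fixes A B :: cmat
  shows "A = B \<longleftrightarrow> A $ 1 $ 1 = B $ 1 $ 1 \<and> A $ 1 $ 2 = B $ 1 $ 2 \<and>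
    A $ 2 $ 1 = B $ 2 $ 1 \<and> A $ 2 $ 2 = B $ 2 $ 2"
  by (auto simp: vec_eq_iff forall_2)

lemma cmat_mult_nth [simp]:
  fixes A B :: cmat
  shows "(A ** B) $ i $ j = A $ i $ 1 * B $ 1 $ j + A $ i $ 2 * B $ 2 $ j"
  by (simp add: matrix_matrix_mult_def sum_2)

lemma cscale_nth [simp]: "(c *m A) $ i $ j = c * A $ i $ j"
  by (simp add: cscale_def)

lemma cmat_one_nth [simp]:
  "(mat 1 :: cmat) $ 1 $ 1 = 1" "(mat 1 :: cmat) $ 1 $ 2 = 0"
  "(mat 1 :: cmat) $ 2 $ 1 = 0" "(mat 1 :: cmat) $ 2 $ 2 = 1"
  by (simp_all add: mat_def)

lemma bounded_bilinear_cmat_mult: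
  "bounded_bilinear ((**) :: cmat \<Rightarrow> cmat \<Rightarrow> cmat)"
  unfolding bilinear_conv_bounded_bilinear[symmetric] bilinear_def linear_iff
  by (simp add: cmat_eq_iff algebra_simps)

interpretation cmm: bounded_bilinear "(**) :: cmat \<Rightarrow> cmat \<Rightarrow> cmat"
  by (rule bounded_bilinear_cmat_mult)

lemma bounded_bilinear_cscale: "bounded_bilinear (*m)"
  unfolding bilinear_conv_bounded_bilinear[symmetric] bilinear_def linear_iff
  by (simp add: cmat_eq_iff algebra_simps)

interpretation csc: bounded_bilinear "(*m)"
  by (rule bounded_bilinear_cscale)

lemma cscale_mult_left: "(c *m A) ** B = c *m (A ** B)"
  and cscale_mult_right: "A ** (c *m B) = c *m (A ** B)"
  and cscale_cscale: "c *m (d *m A) = (c * d) *m A"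
  and cscale_one: "1 *m A = A"
  by (simp_all add: cmat_eq_iff algebra_simps)

lemma norm_nth_nth_le: "norm ((A :: cmat) $ i $ j) \<le> norm A"
  by (meson Finite_Cartesian_Product.norm_nth_le order_trans)

text \<open>The factor 4 is the number of entries; it enters the constants of
  \<open>annulus_split\<close>.\<close>

lemma norm_cmat_le:
  fixes A :: cmat
  assumes "\<And>i j. norm (A $ i $ j) \<le> B"
  shows "norm A \<le> 4 * B"
proof -
  have "norm (A $ i) \<le> 2 * B" for i
  proof -
    have "norm (A $ i) \<le> (\<Sum>j\<in>UNIV. norm (A $ i $ j))"
      by (simp add: L2_set_le_sum norm_vec_def)
    also have "\<dots> \<le> 2 * B"
      using assms[of i 1] assms[of i 2] by (simp add: sum_2)
    finally show ?thesis .
  qed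
  moreover have "norm A \<le> (\<Sum>i\<in>UNIV. norm (A $ i))"
    by (simp add: L2_set_le_sum norm_vec_def)
  ultimately show ?thesis
    by (smt (verit, best) sum_2)
qed

text \<open>The adjugate is the inverse on matrices of determinant 1 but, unlike
  \<^const>\<open>matrix_inv\<close>, it is linear, hence entire and differentiable for free.\<close>

definition adj2 :: "cmat \<Rightarrow> cmat" where
  "adj2 A = mat2 (A $ 2 $ 2) (- A $ 1 $ 2) (- A $ 2 $ 1) (A $ 1 $ 1)"

lemma adj2_nth [simp]:
  "adj2 A $ 1 $ 1 = A $ 2 $ 2" "adj2 A $ 1 $ 2 = - A $ 1 $ 2"
  "adj2 A $ 2 $ 1 = - A $ 2 $ 1" "adj2 A $ 2 $ 2 = A $ 1 $ 1"
  by (simp_all add: adj2_def)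

lemma bounded_linear_adj2: "bounded_linear adj2"
  by (intro linear_conv_bounded_linear[THEN iffD1] linearI) (simp_all add: cmat_eq_iff)

lemma adj2_add: "adj2 (A + B) = adj2 A + adj2 B"
  by (simp add: cmat_eq_iff)

lemma adj2_mult: "adj2 (A ** B) = adj2 B ** adj2 A"
  by (simp add: cmat_eq_iff algebra_simps)

lemma adj2_cscale: "adj2 (c *m A) = c *m adj2 A"
  by (simp add: cmat_eq_iff)

lemma adj2_one [simp]: "adj2 (mat 1) = mat 1"
  by (simp add: cmat_eq_iff)

lemma mult_adj2:
  assumes "det A = 1"
  shows "A ** adj2 A = mat 1" "adj2 A ** A = mat 1"
  using assms by (simp_all add: cmat_eq_iff det_2 algebra_simps)

text \<open>\<open>A ** adj2 A\<close> is \<open>det A\<close> times the identity for every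
  \<open>A\<close>, so a determinant can be handled as a matrix identity, by the identity theorem or
  by differentiation.\<close>

lemma det_eq_1_of_adj2:
  assumes "A ** adj2 A = mat 1"
  shows "det A = 1"
  using assms by (simp add: cmat_eq_iff det_2 algebra_simps)

text \<open>The adjugate is the trace times the identity, minus the matrix.\<close>

lemma adj2_traceless:
  assumes "A $ 1 $ 1 + A $ 2 $ 2 = 0"
  shows "adj2 A = - A"
  using assms by (auto simp: cmat_eq_iff add_eq_0_iff add_eq_0_iff2)

lemma matrix_inv_unique:
  fixes A B :: "'a::semiring_1^'n^'n"
  assumes "A ** B = mat 1" "B ** A = mat 1"
  shows "matrix_inv A = B"
proof -
  have *: "A ** matrix_inv A = mat 1"
    unfolding matrix_inv_def by (rule someI2[of _ B]) (use assms in auto)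
  have "matrix_inv A = (B ** A) ** matrix_inv A"
    by (simp add: assms(2))
  also have "\<dots> = B"
    by (simp add: matrix_mul_assoc[symmetric] *)
  finally show ?thesis .
qed

lemma matrix_inv_eq_adj2:
  assumes "det A = 1"
  shows "matrix_inv A = adj2 A"
  using mult_adj2[OF assms] by (rule matrix_inv_unique)

text \<open>The conjugate transpose and the adjugate are both inverse to \<open>A\<close>; the
  claims compare their entries.\<close>

lemma SU2_conj:
  assumes "A \<in> SU2"
  shows "cnj (A $ 1 $ 1) = A $ 2 $ 2" "cnj (A $ 1 $ 2) = - A $ 2 $ 1" "det A = 1"
proof -
  show d: "det A = 1"
    using assms by (simp add: SU2_def)
  have "conj_transpose A = conj_transpose A ** (A ** adj2 A)"
    by (simp add: mult_adj2[OF d])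
  also have "\<dots> = adj2 A"
    using assms by (simp add: SU2_def matrix_mul_assoc)
  finally have *: "conj_transpose A = adj2 A" .
  have "conj_transpose A $ 1 $ 1 = A $ 2 $ 2" "conj_transpose A $ 2 $ 1 = - A $ 2 $ 1"
    unfolding * by simp_all
  then show "cnj (A $ 1 $ 1) = A $ 2 $ 2" "cnj (A $ 1 $ 2) = - A $ 2 $ 1"
    by (simp_all add: conj_transpose_def)
qed

text \<open>In this form the twisting condition says that the diagonal entries of a loop are even
  and the off-diagonal entries odd in \<lambda>.\<close>

lemma sigma3_conj:
  "sigma3 ** A ** matrix_inv sigma3 =
    mat2 (A $ 1 $ 1) (- A $ 1 $ 2) (- A $ 2 $ 1) (A $ 2 $ 2)"
proof -
  have "matrix_inv sigma3 = sigma3"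
    by (intro matrix_inv_unique) (simp_all add: cmat_eq_iff sigma3_def)
  then show ?thesis
    by (simp add: cmat_eq_iff sigma3_def)
qed

subsection \<open>Entire matrix functions\<close>

definition entire_mat :: "(complex \<Rightarrow> cmat) \<Rightarrow> bool" where
  "entire_mat P \<longleftrightarrow> (\<forall>i j. (\<lambda>z. P z $ i $ j) holomorphic_on UNIV)"

lemma entire_mat_iff:
  "entire_mat P \<longleftrightarrow> (\<lambda>z. P z $ 1 $ 1) holomorphic_on UNIV \<and> (\<lambda>z. P z $ 1 $ 2) holomorphic_on UNIV \<and>
    (\<lambda>z. P z $ 2 $ 1) holomorphic_on UNIV \<and> (\<lambda>z. P z $ 2 $ 2) holomorphic_on UNIV"
  by (auto simp: entire_mat_def forall_2)

lemma entire_mat_const: "entire_mat (\<lambda>z. A)"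
  by (simp add: entire_mat_def)

lemma entire_mat_mult: "entire_mat P \<Longrightarrow> entire_mat Q \<Longrightarrow> entire_mat (\<lambda>z. P z ** Q z)"
  by (auto simp: entire_mat_def intro!: holomorphic_intros)

lemma entire_mat_cscale: "f holomorphic_on UNIV \<Longrightarrow> entire_mat Q \<Longrightarrow> entire_mat (\<lambda>z. f z *m Q z)"
  by (auto simp: entire_mat_def intro!: holomorphic_intros)

lemma entire_mat_add: "entire_mat P \<Longrightarrow> entire_mat Q \<Longrightarrow> entire_mat (\<lambda>z. P z + Q z)"
  by (auto simp: entire_mat_def intro!: holomorphic_intros)

lemma entire_mat_diff: "entire_mat P \<Longrightarrow> entire_mat Q \<Longrightarrow> entire_mat (\<lambda>z. P z - Q z)"
  by (auto simp: entire_mat_def intro!: holomorphic_intros)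

lemma entire_mat_uminus: "entire_mat P \<Longrightarrow> entire_mat (\<lambda>z. - P z)"
  by (auto simp: entire_mat_def intro!: holomorphic_intros)

lemma entire_mat_scaleR: "entire_mat P \<Longrightarrow> entire_mat (\<lambda>z. r *\<^sub>R P z)"
  by (auto simp: entire_mat_def scaleR_conv_of_real intro!: holomorphic_intros)

lemma entire_mat_adj2: "entire_mat P \<Longrightarrow> entire_mat (\<lambda>z. adj2 (P z))"
  by (auto simp: entire_mat_iff intro!: holomorphic_intros)

lemmas entire_mat_intros = entire_mat_const entire_mat_mult entire_mat_cscale entire_mat_add
  entire_mat_diff entire_mat_uminus entire_mat_scaleR entire_mat_adj2

lemma entire_mat_continuous_on:
  assumes "entire_mat P"
  shows "continuous_on S P"
proof -
  have "continuous_on S (\<lambda>z. P z $ i $ j)" for i j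
    using assms holomorphic_on_imp_continuous_on holomorphic_on_subset
    unfolding entire_mat_def by blast
  then have "continuous_on S (\<lambda>z. \<chi> i. \<chi> j. P z $ i $ j)"
    by (intro continuous_on_vec_lambda)
  then show ?thesis
    by simp
qed

text \<open>The difference quotient at 0 has a removable singularity. Splitting off the value at 0
  exactly makes it possible to separate degrees without expanding whole series.\<close>

lemma entire_mat_factor:
  assumes "entire_mat P"
  obtains P1 where "entire_mat P1" "\<And>z. P z = P 0 + z *m P1 z"
proof -
  define P1 :: "complex \<Rightarrow> cmat" where "P1 z = (\<chi> i j. if z = 0 then deriv (\<lambda>z. P z $ i $ j) 0
    else (P z $ i $ j - P 0 $ i $ j) / (z - 0))" for z
  have "entire_mat P1"
    unfolding entire_mat_def
  proof safe
    fix i j :: 2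
    have "(\<lambda>z. if z = 0 then deriv (\<lambda>z. P z $ i $ j) 0
        else (P z $ i $ j - P 0 $ i $ j) / (z - 0)) holomorphic_on UNIV"
      using assms by (intro pole_lemma) (auto simp: entire_mat_def)
    then show "(\<lambda>z. P1 z $ i $ j) holomorphic_on UNIV"
      by (simp add: P1_def)
  qed
  moreover have "P z = P 0 + z *m P1 z" for z
    by (cases "z = 0") (simp_all add: vec_eq_iff P1_def)
  ultimately show thesis
    using that by blast
qed

lemma analytic_eq_from_reals:
  assumes "f holomorphic_on S" "g holomorphic_on S" "open S" "connected S"
    and "of_real ` (UNIV - {0}) \<subseteq> S"
    and "\<And>l::real. l \<noteq> 0 \<Longrightarrow> f (of_real l) = g (of_real l)"
    and "z \<in> S"
  shows "f z = g z"
proof -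
  have "f z - g z = 0"
  proof (rule analytic_continuation[of "\<lambda>z. f z - g z" S "of_real ` (UNIV - {0})" 1])
    show "(\<lambda>z. f z - g z) holomorphic_on S"
      using assms by (intro holomorphic_intros)
    \<comment> \<open>The nonzero reals accumulate at 1, a point that lies in \<open>S\<close> even
      if \<open>S\<close> omits 0.\<close>
    show "(1::complex) islimpt of_real ` (UNIV - {0::real})"
      unfolding islimpt_approachable
    proof safe
      fix e :: real assume "e > 0"
      then show "\<exists>x'\<in>complex_of_real ` (UNIV - {0}). x' \<noteq> 1 \<and> dist x' 1 < e"
        by (intro bexI[of _ "of_real (1 + e/2)"] imageI) (auto simp: dist_norm)
    qed
    show "1 \<in> S"
      using assms(5) by (metis DiffI UNIV_I image_subset_iff of_real_1 singletonD zero_neq_one)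
    show "f w - g w = 0" if "w \<in> of_real ` (UNIV - {0})" for w
      using that assms(6) by auto
  qed (fact assms)+
  then show ?thesis
    by simp
qed

lemma entire_mat_eq_from_reals:
  assumes "entire_mat P" "entire_mat Q" "\<And>l::real. l \<noteq> 0 \<Longrightarrow> P (of_real l) = Q (of_real l)"
  shows "P z = Q z"
proof -
  have "P z $ i $ j = Q z $ i $ j" for i j
    by (rule analytic_eq_from_reals[of "\<lambda>z. P z $ i $ j" UNIV "\<lambda>z. Q z $ i $ j"])
      (use assms in \<open>auto simp: entire_mat_def\<close>)
  then show ?thesis
    by (simp add: vec_eq_iff)
qed

subsection \<open>Splitting on an annulus\<close>

lemma max_modulus_cball:
  assumes "f holomorphic_on UNIV" "0 < r" "\<And>z. norm z = r \<Longrightarrow> norm (f z) \<le> B" "norm z \<le> r"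
  shows "norm (f z) \<le> B"
proof (rule maximum_modulus_frontier[of f "cball 0 r"])
  show "f holomorphic_on interior (cball 0 r)" "continuous_on (closure (cball 0 r)) f"
    using assms(1) holomorphic_on_subset holomorphic_on_imp_continuous_on
      continuous_on_subset by blast+
qed (use assms in \<open>auto simp: dist_norm frontier_cball\<close>)

text \<open>Dividing by \<open>z\<close> removes the zero at 0; the maximum principle on the circle
  of radius \<open>r\<close> bounds the quotient by \<open>B / r\<close>.\<close>

lemma schwarz_entire:
  assumes "f holomorphic_on UNIV" "f 0 = 0" "0 < r" "\<And>z. norm z = r \<Longrightarrow> norm (f z) \<le> B" "norm z \<le> r"
  shows "norm (f z) \<le> B * norm z / r"
proof -
  define g where "g z = (if z = 0 then deriv f 0 else (f z - f 0) / (z - 0))" for z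
  have "g holomorphic_on UNIV"
    unfolding g_def using assms by (intro pole_lemma) auto
  moreover have "norm (g z) \<le> B / r" if "norm z = r" for z
    using assms that by (auto simp: g_def norm_divide divide_right_mono)
  ultimately have "norm (g z) \<le> B / r"
    using max_modulus_cball[of g r "B / r" z] assms(3,5) by blast
  moreover have "f z = z * g z"
    using assms(2) by (simp add: g_def)
  ultimately have "norm (f z) \<le> norm z * (B / r)"
    by (metis norm_ge_zero norm_mult mult_left_mono)
  then show ?thesis
    by (simp add: mult.commute)
qed

text \<open>This replaces the boundedness of the Riesz projections, which fails in the sup norm on a
  single circle. If \<open>m\<close> is the maximum of \<open>\<bar>q\<bar>\<close> on \<open>\<bar>z\<bar> = 1/r\<close>, then \<open>q\<close> is at most \<open>m/2\<close> on
  \<open>\<bar>z\<bar> = 1/(2r)\<close> by the Schwarz lemma. Going over to \<open>p\<close> on the outer circle, back to the inner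
  circle by the maximum principle, and then to \<open>q\<close> again gives \<open>m \<le> m/2 + 2B\<close>.\<close>

lemma annulus_split_scalar:
  assumes p: "p holomorphic_on UNIV" and q: "q holomorphic_on UNIV" and "q 0 = 0" and "0 < r"
    and B: "\<And>l. r \<le> norm l \<Longrightarrow> norm l \<le> 2 * r \<Longrightarrow> norm (p l - q (1 / l)) \<le> B"
  shows "norm z \<le> 1 / r \<Longrightarrow> norm (q z) \<le> 4 * B"
    and "norm l \<le> 2 * r \<Longrightarrow> norm (p l) \<le> 5 * B"
proof -
  have "compact (sphere (0::complex) (1 / r))" "sphere (0::complex) (1 / r) \<noteq> {}"
    using \<open>0 < r\<close> by auto
  moreover have "continuous_on (sphere 0 (1 / r)) (\<lambda>z. norm (q z))"
    by (intro continuous_on_norm holomorphic_on_imp_continuous_on holomorphic_on_subset[OF q]) simp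
  ultimately obtain z0 where z0: "z0 \<in> sphere 0 (1 / r)"
    "\<And>z. z \<in> sphere 0 (1 / r) \<Longrightarrow> norm (q z) \<le> norm (q z0)"
    using continuous_attains_sup[of "sphere 0 (1 / r)" "\<lambda>z. norm (q z)"] by blast
  define m where "m = norm (q z0)"
  have m: "norm (q z) \<le> m" if "norm z = 1 / r" for z
    using z0(2)[of z] that by (simp add: m_def)
  have "norm (p l) \<le> m / 2 + B" if "norm l = 2 * r" for l
  proof -
    have *: "norm (1 / l) = 1 / r / 2"
      using that \<open>0 < r\<close> by (simp add: norm_divide)
    have "norm (q (1 / l)) \<le> m * norm (1 / l) / (1 / r)"
      by (rule schwarz_entire[OF q]) (use assms(3,4) m * in \<open>auto simp: divide_simps\<close>)
    also have "\<dots> = m / 2"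
      using * \<open>0 < r\<close> by simp
    finally have "norm (q (1 / l)) \<le> m / 2" .
    moreover have "norm (p l - q (1 / l)) \<le> B"
      by (rule B) (use that \<open>0 < r\<close> in auto)
    ultimately show ?thesis
      by (smt (verit) norm_triangle_sub)
  qed
  then have pl: "norm (p l) \<le> m / 2 + B" if "norm l \<le> 2 * r" for l
    using max_modulus_cball[OF p, of "2 * r"] that \<open>0 < r\<close> by simp
  have "norm (1 / z0) = r"
    using z0 \<open>0 < r\<close> by (simp add: norm_divide)
  then have "norm (p (1 / z0) - q (1 / (1 / z0))) \<le> B" "norm (p (1 / z0)) \<le> m / 2 + B"
    using \<open>0 < r\<close> B[of "1 / z0"] pl[of "1 / z0"] by auto
  then have "m \<le> (m / 2 + B) + B"
    using norm_triangle_sub[of "q z0" "p (1 / z0)"] by (simp add: m_def norm_minus_commute)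
  then have m4: "m \<le> 4 * B"
    by simp
  show "norm (q z) \<le> 4 * B" if "norm z \<le> 1 / r"
    using max_modulus_cball[OF q, of "1 / r" m z] m that \<open>0 < r\<close> m4 by simp
  have "0 \<le> m"
    by (simp add: m_def)
  with m4 show "norm (p l) \<le> 5 * B" if "norm l \<le> 2 * r"
    using pl[OF that] by simp
qed

text \<open>The scalar case is applied to each entry; returning to the matrix norm multiplies its
  constants 4 and 5 by 4.\<close>

lemma annulus_split:
  assumes p: "entire_mat p" and q: "entire_mat q" and "q 0 = 0" and "0 < r"
    and B: "\<And>l. r \<le> norm l \<Longrightarrow> norm l \<le> 2 * r \<Longrightarrow> norm (p l - q (1 / l)) \<le> B"
  shows "norm z \<le> 1 / r \<Longrightarrow> norm (q z) \<le> 16 * B"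
    and "norm l \<le> 2 * r \<Longrightarrow> norm (p l) \<le> 20 * B"
proof -
  have *: "norm (p l $ i $ j - q (1 / l) $ i $ j) \<le> B"
    if "r \<le> norm l" "norm l \<le> 2 * r" for l and i j :: 2
    using norm_nth_nth_le[of "p l - q (1 / l)" i j] B[OF that] by simp
  have hol: "(\<lambda>z. p z $ i $ j) holomorphic_on UNIV" "(\<lambda>z. q z $ i $ j) holomorphic_on UNIV" for i j
    using p q by (auto simp: entire_mat_def)
  have "q 0 $ i $ j = 0" for i j
    by (simp add: assms(3))
  note ** = annulus_split_scalar[OF hol this \<open>0 < r\<close> *]
  show "norm (q z) \<le> 16 * B" if "norm z \<le> 1 / r"
    using norm_cmat_le[OF **(1)[OF _ _ that]] by simp
  show "norm (p l) \<le> 20 * B" if "norm l \<le> 2 * r"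
    using norm_cmat_le[OF **(2)[OF _ _ that]] by simp
qed

text \<open>After subtraction of \<open>A\<close> the splitting applies with error bound 0. This is
  the Liouville argument behind the uniqueness of the Birkhoff factorization.\<close>

lemma annulus_split_eq:
  assumes p: "entire_mat p" and q: "entire_mat q" and "q 0 = A"
    and eq: "\<And>l. l \<noteq> 0 \<Longrightarrow> p l = q (1 / l)"
  shows "q z = A" "p l = A"
proof -
  \<comment> \<open>Small enough that \<open>z\<close> lies in the disc of radius
    \<open>1 / r\<close>; in the second claim \<open>norm l + 1\<close> puts \<open>l\<close> into
    the outer disc.\<close>
  define r where "r = min (1 / (1 + norm z)) 1"
  have r: "r > 0" "norm z \<le> 1 / r"
    by (auto simp: r_def min_def field_simps add_pos_nonneg)
  have ent: "entire_mat (\<lambda>z. p z - A)" "entire_mat (\<lambda>z. q z - A)"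
    using p q by (auto intro!: entire_mat_intros)
  have le: "norm ((p l - A) - (q (1 / l) - A)) \<le> 0" if "s \<le> norm l" "0 < s" for l s
  proof -
    have "l \<noteq> 0"
      using that by auto
    from eq[OF this] show ?thesis
      by simp
  qed
  have "norm (q z - A) \<le> 16 * 0"
    by (rule annulus_split(1)[OF ent _ r(1) le]) (use assms(3) r in auto)
  then show "q z = A"
    by simp
  have "norm (p l - A) \<le> 20 * 0"
    by (rule annulus_split(2)[OF ent _ _ le, where r = "norm l + 1"])
      (use assms(3) norm_ge_zero[of l] in \<open>auto simp del: norm_ge_zero\<close>)
  then show "p l = A"
    by simp
qed

subsection \<open>Loops as entire functions of \<open>\<lambda>\<close> or of \<open>1/\<lambda>\<close>\<close>

lemma entire_of_real_power_series:
  fixes a :: "nat \<Rightarrow> cmat"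
  assumes "\<And>l::real. l \<noteq> 0 \<Longrightarrow> (\<lambda>n. l ^ n *\<^sub>R a n) sums g l"
  obtains P where "entire_mat P" "\<And>l. l \<noteq> 0 \<Longrightarrow> g l = P (of_real l)" "P 0 = a 0"
proof -
  have entry: "(\<lambda>n. a n $ i $ j * of_real l ^ n) sums (g l $ i $ j)" if "l \<noteq> 0" for l i j
  proof -
    have "bounded_linear (\<lambda>A::cmat. A $ i $ j)"
      by (intro linear_conv_bounded_linear[THEN iffD1] linearI) simp_all
    from bounded_linear.sums[OF this assms[OF that]] show ?thesis
      by (simp add: scaleR_conv_of_real[where 'a=complex] mult.commute)
  qed
  \<comment> \<open>Convergence at the real point \<open>norm z + 1\<close> gives absolute
    convergence at \<open>z\<close>, so the radius of convergence is infinite.\<close>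
  have summ: "summable (\<lambda>n. a n $ i $ j * z ^ n)" for i j and z :: complex
    using powser_inside[OF sums_summable[OF entry[of "norm z + 1"]], of z i j]
      norm_ge_zero[of z] by (auto dest!: summable_norm_cancel simp: simp del: norm_ge_zero)
  define P :: "complex \<Rightarrow> cmat" where "P z = (\<chi> i j. \<Sum>n. a n $ i $ j * z ^ n)" for z
  have "(\<lambda>z. \<Sum>n. a n $ i $ j * z ^ n) holomorphic_on ball 0 r" for i j r
    using summ[of i j] by (intro power_series_holomorphic[where a = "\<lambda>n. a n $ i $ j"]) (simp add: summable_sums)
  then have "(\<lambda>z. \<Sum>n. a n $ i $ j * z ^ n) field_differentiable at z" for i j z
    by (rule holomorphic_on_imp_differentiable_at[where s = "ball 0 (norm z + 1)"]) auto
  then have "entire_mat P"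
    by (simp add: entire_mat_def P_def holomorphic_on_def field_differentiable_at_within)
  moreover have "g l = P (of_real l)" if "l \<noteq> 0" for l
    using entry[OF that] by (simp add: vec_eq_iff P_def sums_iff)
  moreover have "P 0 = a 0"
    by (simp add: vec_eq_iff P_def)
  ultimately show thesis
    using that by blast
qed

text \<open>Loops live on the nonzero reals, so their symmetries reach the constant term of an
  expansion by continuity.\<close>

lemma continuous_eq_at_0:
  fixes f g :: "real \<Rightarrow> 'a::t2_space"
  assumes "isCont f 0" "isCont g 0" "\<And>x. x \<noteq> 0 \<Longrightarrow> f x = g x"
  shows "f 0 = g 0"
proof -
  have "(f \<longlongrightarrow> f 0) (at 0)" "(g \<longlongrightarrow> g 0) (at 0)"
    using assms by (simp_all add: isCont_def)
  moreover have "\<forall>\<^sub>F x in at 0. f x = g x"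
    using assms(3) by (auto simp: eventually_at_filter)
  ultimately show ?thesis
    using tendsto_cong[of f g "at 0" "f 0"] tendsto_unique[of "at (0::real)" g "f 0" "g 0"] by simp
qed

lemma entire_mat_isCont_real:
  assumes "entire_mat P"
  shows "isCont (\<lambda>x::real. P (of_real x) $ i $ j) a" "isCont (\<lambda>x::real. P (- of_real x) $ i $ j) a"
proof -
  have *: "isCont (\<lambda>z. P z $ i $ j) z" for z
    using assms holomorphic_on_imp_continuous_on continuous_on_eq_continuous_at open_UNIV
    unfolding entire_mat_def by blast
  show "isCont (\<lambda>x::real. P (of_real x) $ i $ j) a"
    by (rule isCont_o2[OF _ *]) (intro continuous_intros)
  show "isCont (\<lambda>x::real. P (- of_real x) $ i $ j) a"
    by (rule isCont_o2[OF _ *]) (intro continuous_intros)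
qed

lemma Loop_SU2_D:
  assumes "g \<in> Loop_SU2" "l \<noteq> 0"
  shows "g l \<in> SU2" "g (- l) = mat2 (g l $ 1 $ 1) (- g l $ 1 $ 2) (- g l $ 2 $ 1) (g l $ 2 $ 2)"
  using assms unfolding Loop_SU2_def sigma3_conj by blast+

lemma entire_mat_det_1:
  assumes "entire_mat P" "\<And>l::real. l \<noteq> 0 \<Longrightarrow> det (P (of_real l)) = 1"
  shows "det (P z) = 1"
proof -
  have "P z ** adj2 (P z) = mat 1"
    by (rule entire_mat_eq_from_reals[of "\<lambda>z. P z ** adj2 (P z)" "\<lambda>z. mat 1"])
      (intro entire_mat_intros assms mult_adj2; assumption)+
  then show ?thesis
    by (rule det_eq_1_of_adj2)
qed

text \<open>At 0 the odd off-diagonal entries vanish, while the unitarity relation between the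
  diagonal entries survives. What remains is a single complex number, which later carries the
  phase.\<close>

lemma Loop_plus_entire:
  assumes "g \<in> Loop_plus"
  obtains P where "entire_mat P" "\<And>l. l \<noteq> 0 \<Longrightarrow> g l = P (of_real l)" "\<And>z. det (P z) = 1"
    "P 0 $ 1 $ 2 = 0" "P 0 $ 2 $ 1 = 0" "P 0 $ 2 $ 2 = cnj (P 0 $ 1 $ 1)"
proof -
  from assms have loop: "g \<in> Loop_SU2"
    by (simp add: Loop_plus_def)
  obtain a where "\<And>l. l \<noteq> 0 \<Longrightarrow> (\<lambda>n. l ^ n *\<^sub>R a n) sums g l"
    using assms by (auto simp: Loop_plus_def)
  then obtain P where P: "entire_mat P" "\<And>l. l \<noteq> 0 \<Longrightarrow> g l = P (of_real l)"
    using entire_of_real_power_series[of a g] by blast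
  note S = SU2_conj[OF Loop_SU2_D(1)[OF loop]] and tw = Loop_SU2_D(2)[OF loop]
  have det: "det (P z) = 1" for z
    by (rule entire_mat_det_1[OF P(1)]) (use S(3) P(2) in metis)
  note cont = entire_mat_isCont_real[OF P(1)]
  have PS: "P (- of_real l) $ 1 $ 2 = - P (of_real l) $ 1 $ 2" "P (- of_real l) $ 2 $ 1 = - P (of_real l) $ 2 $ 1"
    "cnj (P (of_real l) $ 1 $ 1) = P (of_real l) $ 2 $ 2" if "l \<noteq> 0" for l :: real
    using S(1)[OF that] tw[OF that] P(2)[of l] P(2)[of "- l"] that by simp_all
  have "P (- of_real 0) $ 1 $ 2 = - P (of_real 0) $ 1 $ 2"
    by (rule continuous_eq_at_0) (intro continuous_intros cont PS | assumption)+
  moreover have "P (- of_real 0) $ 2 $ 1 = - P (of_real 0) $ 2 $ 1"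
    by (rule continuous_eq_at_0) (intro continuous_intros cont PS | assumption)+
  moreover have "cnj (P (of_real 0) $ 1 $ 1) = P (of_real 0) $ 2 $ 2"
    by (rule continuous_eq_at_0) (intro continuous_intros cont PS | assumption)+
  ultimately show thesis
    using that[of P] P det by simp
qed

text \<open>Replacing \<open>l\<close> by \<open>1 / l\<close> turns the expansion at infinity into
  one at 0 and preserves parity. The symmetries on the real line are recorded for the study of the
  linear coefficient of \<open>Q\<close>.\<close>

lemma Loop_minus_star_entire:
  assumes "g \<in> Loop_minus_star"
  obtains Q where "entire_mat Q" "\<And>l. l \<noteq> 0 \<Longrightarrow> g l = Q (1 / of_real l)" "\<And>z. det (Q z) = 1"
    "Q 0 = mat 1"
    "\<And>l::real. l \<noteq> 0 \<Longrightarrow> Q (of_real l) \<in> SU2"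
    "\<And>l::real. l \<noteq> 0 \<Longrightarrow> Q (- of_real l) $ 1 $ 1 = Q (of_real l) $ 1 $ 1"
proof -
  from assms have loop: "g \<in> Loop_SU2"
    by (simp add: Loop_minus_star_def)
  obtain a where a: "a 0 = mat 1" "\<And>l. l \<noteq> 0 \<Longrightarrow> (\<lambda>n. inverse l ^ n *\<^sub>R a n) sums g l"
    using assms by (auto simp: Loop_minus_star_def)
  have "(\<lambda>n. l ^ n *\<^sub>R a n) sums g (1 / l)" if "l \<noteq> 0" for l
    using a(2)[of "1 / l"] that by simp
  then obtain Q where Q: "entire_mat Q" "\<And>l. l \<noteq> 0 \<Longrightarrow> g (1 / l) = Q (of_real l)" "Q 0 = a 0"
    using entire_of_real_power_series[of a "\<lambda>l. g (1 / l)"] by blast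
  have Q_SU2: "Q (of_real l) \<in> SU2" if "l \<noteq> 0" for l
    using Loop_SU2_D(1)[OF loop, of "1 / l"] that by (simp flip: Q(2))
  have "det (Q z) = 1" for z
    by (rule entire_mat_det_1[OF Q(1)]) (rule SU2_conj(3)[OF Q_SU2])
  moreover have "Q (- of_real l) $ 1 $ 1 = Q (of_real l) $ 1 $ 1" if "l \<noteq> 0" for l :: real
  proof -
    have "Q (- of_real l) = mat2 (Q (of_real l) $ 1 $ 1) (- Q (of_real l) $ 1 $ 2)
        (- Q (of_real l) $ 2 $ 1) (Q (of_real l) $ 2 $ 2)"
      using Loop_SU2_D(2)[OF loop, of "1 / l"] Q(2)[of l] Q(2)[of "- l"] that by simp
    then show ?thesis
      by (metis mat2_nth(1))
  qed
  moreover have "g l = Q (1 / of_real l)" if "l \<noteq> 0" for l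
    using Q(2)[of "1 / l"] that by simp
  ultimately show thesis
    using that[of Q] Q a Q_SU2 by simp
qed

text \<open>The upper left entry of \<open>Q\<close> is even, so its linear coefficient vanishes;
  \<open>SU2\<close> on the real line determines the lower row from the upper one. This shape makes
  the diagonal coefficient in the \<open>x\<close> equation real.\<close>

lemma twisted_linear_coeff:
  assumes Q: "entire_mat Q1" "\<And>z. Q z = mat 1 + z *m Q1 z"
    and "\<And>l::real. l \<noteq> 0 \<Longrightarrow> Q (of_real l) \<in> SU2"
    and "\<And>l::real. l \<noteq> 0 \<Longrightarrow> Q (- of_real l) $ 1 $ 1 = Q (of_real l) $ 1 $ 1"
  obtains b where "Q1 0 = mat2 0 b (- cnj b) 0"
proof -
  have Q1: "Q1 (of_real l) $ 1 $ 1 = - Q1 (- of_real l) $ 1 $ 1"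
     "cnj (Q1 (of_real l) $ 1 $ 1) = Q1 (of_real l) $ 2 $ 2"
     "cnj (Q1 (of_real l) $ 1 $ 2) = - Q1 (of_real l) $ 2 $ 1" if "l \<noteq> 0" for l :: real
  proof -
    have l: "complex_of_real l \<noteq> 0"
      using that by simp
    have "of_real l * Q1 (of_real l) $ 1 $ 1 = of_real l * (- Q1 (- of_real l) $ 1 $ 1)"
      using assms(4)[OF that] by (simp add: Q(2))
    then show "Q1 (of_real l) $ 1 $ 1 = - Q1 (- of_real l) $ 1 $ 1"
      unfolding mult_left_cancel[OF l] .
    have "of_real l * cnj (Q1 (of_real l) $ 1 $ 1) = of_real l * Q1 (of_real l) $ 2 $ 2"
      "of_real l * cnj (Q1 (of_real l) $ 1 $ 2) = of_real l * (- Q1 (of_real l) $ 2 $ 1)"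
      using SU2_conj(1,2)[OF assms(3)[OF that]] by (simp_all add: Q(2))
    then show "cnj (Q1 (of_real l) $ 1 $ 1) = Q1 (of_real l) $ 2 $ 2"
      "cnj (Q1 (of_real l) $ 1 $ 2) = - Q1 (of_real l) $ 2 $ 1"
      unfolding mult_left_cancel[OF l] .
  qed
  note cont = entire_mat_isCont_real[OF Q(1)]
  have "Q1 (of_real 0) $ 1 $ 1 = - Q1 (- of_real 0) $ 1 $ 1"
    by (rule continuous_eq_at_0) (intro continuous_intros cont Q1 | assumption)+
  moreover have "cnj (Q1 (of_real 0) $ 1 $ 1) = Q1 (of_real 0) $ 2 $ 2"
    by (rule continuous_eq_at_0) (intro continuous_intros cont Q1 | assumption)+
  moreover have "cnj (Q1 (of_real 0) $ 1 $ 2) = - Q1 (of_real 0) $ 2 $ 1"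
    by (rule continuous_eq_at_0) (intro continuous_intros cont Q1 | assumption)+
  ultimately show thesis
    using that[of "Q1 0 $ 1 $ 2"] by (simp add: cmat_eq_iff)
qed

subsection \<open>The linear differential equation with complex spectral parameter\<close>

lemma entire_mat_sums:
  assumes "\<And>z. (\<lambda>n. z ^ n *m a n) sums P z"
  shows "entire_mat P"
  unfolding entire_mat_def
proof safe
  fix i j :: 2
  have "(\<lambda>n. a n $ i $ j * z ^ n) sums (P z $ i $ j)" for z
  proof -
    have "bounded_linear (\<lambda>A::cmat. A $ i $ j)"
      by (intro linear_conv_bounded_linear[THEN iffD1] linearI) simp_all
    from bounded_linear.sums[OF this assms] show ?thesis
      by (simp add: mult.commute)
  qed
  then have "(\<lambda>z. P z $ i $ j) holomorphic_on ball 0 r" for r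
    by (intro power_series_holomorphic[where a = "\<lambda>n. a n $ i $ j"]) simp
  then have "(\<lambda>z. P z $ i $ j) field_differentiable at z" for z
    by (rule holomorphic_on_imp_differentiable_at[where s = "ball 0 (norm z + 1)"]) auto
  then show "(\<lambda>z. P z $ i $ j) holomorphic_on UNIV"
    by (simp add: holomorphic_on_def field_differentiable_at_within)
qed

text \<open>Coefficients of the Picard (Peano-Baker) series for \<open>W' = z W A\<close> with the
  identity as value at \<open>a\<close>: the power \<open>z ^ n\<close> goes with the
  \<open>n\<close>-fold integral.\<close>

primrec iterated_integral :: "real \<Rightarrow> (real \<Rightarrow> cmat) \<Rightarrow> nat \<Rightarrow> real \<Rightarrow> cmat" where
  "iterated_integral a A 0 x = mat 1"
| "iterated_integral a A (Suc n) x = integral {a..x} (\<lambda>s. iterated_integral a A n s ** A s)"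

lemma continuous_on_iterated_integral:
  assumes "continuous_on {a..b} A"
  shows "continuous_on {a..b} (iterated_integral a A n)"
proof (induction n)
  case (Suc n)
  then show ?case
    using assms unfolding iterated_integral.simps
    by (intro indefinite_integral_continuous_1 integrable_continuous_real cmm.continuous_on)
qed (simp add: continuous_on_const)

text \<open>Each integration turns \<open>(s - a) ^ n / fact n\<close> into the next term of this
  kind. The constant \<open>C\<close> also takes up the constant in the norm bound for matrix
  products.\<close>

lemma norm_iterated_integral_le:
  assumes "continuous_on {a..b} A" and "x \<in> {a..b}"
    and "\<And>(P::cmat) x. x \<in> {a..b} \<Longrightarrow> norm (P ** A x) \<le> C * norm P"
    and "0 \<le> C"
  shows "norm (iterated_integral a A n x) \<le> norm (mat 1 :: cmat) * (C * (x - a)) ^ n / fact n"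
  using \<open>x \<in> {a..b}\<close>
proof (induction n arbitrary: x)
  case (Suc n)
  \<comment> \<open>One factor \<open>C\<close> more than in the bound for \<open>n\<close>, since
    the integrand contains \<open>A\<close>.\<close>
  define B where "B = norm (mat 1 :: cmat) * C ^ Suc n"
  have x: "{a..x} \<subseteq> {a..b}" "a \<le> x"
    using Suc.prems by auto
  have "B / fact (Suc n) * (real (Suc n) * (s - a) ^ n) = B * (s - a) ^ n / fact n" for s
    by (simp del: of_nat_Suc)
  moreover have "((\<lambda>s. B / fact (Suc n) * (s - a) ^ Suc n) has_real_derivative
      B / fact (Suc n) * (real (Suc n) * (s - a) ^ n)) (at s within {a..x})" for s
    by (rule derivative_eq_intros refl | simp)+
  ultimately have deriv: "((\<lambda>s. B / fact (Suc n) * (s - a) ^ Suc n) has_vector_derivative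
      B * (s - a) ^ n / fact n) (at s within {a..x})" for s
    unfolding has_real_derivative_iff_has_vector_derivative[symmetric] by metis
  have int: "((\<lambda>s. B * (s - a) ^ n / fact n) has_integral B * (x - a) ^ Suc n / fact (Suc n)) {a..x}"
    using fundamental_theorem_of_calculus[OF x(2) deriv] by (simp del: fact_Suc)
  have "norm (iterated_integral a A (Suc n) x) \<le> integral {a..x} (\<lambda>s. B * (s - a) ^ n / fact n)"
    unfolding iterated_integral.simps
  proof (rule integral_norm_bound_integral)
    show "(\<lambda>s. iterated_integral a A n s ** A s) integrable_on {a..x}"
      using continuous_on_subset[OF _ x(1)] assms(1) continuous_on_iterated_integral[OF assms(1)]
      by (intro integrable_continuous_real cmm.continuous_on) auto
    show "(\<lambda>s. B * (s - a) ^ n / fact n) integrable_on {a..x}"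
      using int by blast
    fix s assume s: "s \<in> {a..x}"
    then have s': "s \<in> {a..b}"
      using x by auto
    have "norm (iterated_integral a A n s ** A s) \<le> C * norm (iterated_integral a A n s)"
      by (rule assms(3)[OF s'])
    also have "\<dots> \<le> C * (norm (mat 1 :: cmat) * (C * (s - a)) ^ n / fact n)"
      by (intro mult_left_mono Suc.IH s' assms(4))
    also have "\<dots> = B * (s - a) ^ n / fact n"
      by (simp add: B_def power_mult_distrib mult_ac)
    finally show "norm (iterated_integral a A n s ** A s) \<le> B * (s - a) ^ n / fact n" .
  qed
  also have "\<dots> = norm (mat 1 :: cmat) * (C * (x - a)) ^ Suc n / fact (Suc n)"
    using integral_unique[OF int] by (simp add: B_def power_mult_distrib mult_ac)
  finally show ?case .
qed simp

text \<open>The spectral parameter enters through \<open>z ^ n\<close>, so the Picard series is a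
  power series in \<open>z\<close>; a majorant uniform for \<open>norm z \<le> r\<close> gives
  continuity in both variables. Differentiability in \<open>x\<close> comes from the integral
  equation, which is obtained by integrating the partial sums.\<close>

lemma ode_series:
  assumes "continuous_on {a..b} A"
  obtains W where "\<And>z. W a z = mat 1"
    "\<And>x z. x \<in> {a..b} \<Longrightarrow>
       ((\<lambda>x. W x z) has_vector_derivative z *m (W x z ** A x)) (at x within {a..b})"
    "\<And>x. x \<in> {a..b} \<Longrightarrow> entire_mat (W x)"
    "\<And>r. continuous_on ({a..b} \<times> cball 0 r) (\<lambda>(x, z). W x z)"
proof -
  define w where "w n x z = z ^ n *m iterated_integral a A n x" for n x z
  \<comment> \<open>The default value serves the empty interval, where the initial condition at
    \<open>a\<close> is still claimed.\<close>
  define W where "W x z = (if x \<in> {a..b} then \<Sum>n. w n x z else mat 1)" for x z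
  obtain K where K: "K > 0" "\<And>(P::cmat) (Q::cmat). norm (P ** Q) \<le> norm P * norm Q * K"
    using cmm.pos_bounded by metis
  obtain L where L: "L > 0" "\<And>z Q. norm (z *m Q) \<le> norm z * norm Q * L"
    using csc.pos_bounded by metis
  have "bounded (A ` {a..b})"
    using assms compact_continuous_image compact_imp_bounded compact_Icc by blast
  then obtain M where M: "M > 0" "\<And>x. x \<in> {a..b} \<Longrightarrow> norm (A x) \<le> M"
    unfolding bounded_pos by blast
  define C where "C = M * K"
  have C: "C \<ge> 0"
    using M K by (simp add: C_def)
  have PA: "norm (P ** A x) \<le> C * norm P" if "x \<in> {a..b}" for x and P :: cmat
  proof -
    have "norm (P ** A x) \<le> norm P * norm (A x) * K"
      by (rule K(2))
    also have "\<dots> \<le> norm P * M * K"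
      using M(2)[OF that] K(1) by (intro mult_right_mono mult_left_mono) auto
    finally show ?thesis
      by (simp add: C_def mult_ac)
  qed
  \<comment> \<open>Terms of an exponential series, with \<open>x - a\<close> replaced by the length
    of the interval.\<close>
  define m where "m r n = L * norm (mat 1 :: cmat) * (inverse (fact n) * (r * C * (b - a)) ^ n)" for r n
  have m_summable: "summable (m r)" for r
    unfolding m_def by (intro summable_mult summable_exp)
  have w_le: "norm (w n x z) \<le> m r n" if "x \<in> {a..b}" "norm z \<le> r" for n x z r
  proof -
    have r: "0 \<le> r"
      using that(2) norm_ge_zero order_trans by blast
    have "norm (iterated_integral a A n x) \<le> norm (mat 1 :: cmat) * (C * (x - a)) ^ n / fact n"
      using norm_iterated_integral_le[OF assms that(1) PA C] .
    also have "\<dots> \<le> norm (mat 1 :: cmat) * (C * (b - a)) ^ n / fact n"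
      using that C by (intro divide_right_mono mult_left_mono power_mono) auto
    finally have "norm (z ^ n) * norm (iterated_integral a A n x) * L
        \<le> r ^ n * (norm (mat 1 :: cmat) * (C * (b - a)) ^ n / fact n) * L"
      using L(1) that r by (intro mult_right_mono mult_mono) (auto simp: norm_power power_mono)
    also have "\<dots> = m r n"
      by (simp add: m_def power_mult_distrib divide_inverse mult_ac)
    finally show ?thesis
      using L(2)[of "z ^ n" "iterated_integral a A n x"] by (simp add: w_def)
  qed
  have w_cont: "continuous_on ({a..b} \<times> cball 0 r) (\<lambda>p. w n (fst p) (snd p))" for n r
    unfolding w_def
    by (intro csc.continuous_on continuous_intros
        continuous_on_compose2[OF continuous_on_iterated_integral[OF assms]]) auto
  have unif: "uniform_limit ({a..b} \<times> cball 0 r) (\<lambda>n p. \<Sum>i<n. w i (fst p) (snd p))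
      (\<lambda>p. \<Sum>i. w i (fst p) (snd p)) sequentially" for r
    by (rule Weierstrass_m_test[OF _ m_summable[of r]]) (auto intro!: w_le)
  have cont: "continuous_on ({a..b} \<times> cball 0 r) (\<lambda>(x, z). W x z)" for r
  proof -
    have "continuous_on ({a..b} \<times> cball 0 r) (\<lambda>p. \<Sum>i. w i (fst p) (snd p))"
      by (rule uniform_limit_theorem[OF _ unif])
        (auto intro!: always_eventually continuous_on_sum w_cont)
    then show ?thesis
      by (rule continuous_on_eq) (auto simp: W_def)
  qed
  have sums: "(\<lambda>n. w n x z) sums W x z" if "x \<in> {a..b}" for x z
    using that summable_comparison_test[OF _ m_summable[of "norm z"], of "\<lambda>n. w n x z"] w_le[OF that order_refl]
    by (auto simp: W_def summable_sums)
  define S where "S n x z = (\<Sum>i<n. w i x z)" for n x z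
  have W_cont: "continuous_on {a..b} (\<lambda>x. W x z)" for z
    by (rule continuous_on_compose2[OF cont[of "norm z"], of _ "\<lambda>x. (x, z)", simplified])
      (auto intro!: continuous_intros)
  have S_cont: "continuous_on {a..b} (\<lambda>x. S n x z)" for n z
    unfolding S_def w_def
    by (intro csc.continuous_on continuous_intros continuous_on_iterated_integral assms)
  \<comment> \<open>Differentiation shifts the index, so the derivative of a partial sum contains
    the partial sum with one term less.\<close>
  have S_deriv: "((\<lambda>x. S (Suc n) x z) has_vector_derivative z *m (S n x z ** A x)) (at x within {a..b})"
    if "x \<in> {a..b}" for n x z
  proof (induction n)
    case 0
    show ?case
      by (simp add: S_def w_def cmm.zero_left csc.zero_right)
  next
    case (Suc n)
    have "((\<lambda>x. iterated_integral a A (Suc n) x) has_vector_derivative iterated_integral a A n x ** A x)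
        (at x within {a..b})"
      unfolding iterated_integral.simps
      by (intro integral_has_vector_derivative cmm.continuous_on assms
          continuous_on_iterated_integral that)
    then have "((\<lambda>x. w (Suc n) x z) has_vector_derivative z ^ Suc n *m (iterated_integral a A n x ** A x))
        (at x within {a..b})"
      unfolding w_def by (rule bounded_linear.has_vector_derivative[OF csc.bounded_linear_right])
    from has_vector_derivative_add[OF Suc this] show ?case
      by (simp add: S_def w_def cmm.add_left csc.add_right cscale_mult_left cscale_cscale)
  qed
  have W_int: "W x z = mat 1 + integral {a..x} (\<lambda>s. z *m (W s z ** A s))" if x: "x \<in> {a..b}" for x z
  proof -
    have sub: "{a..x} \<subseteq> {a..b}"
      using x by auto
    have "uniform_limit {a..b} (\<lambda>n s. S n s z) (\<lambda>s. W s z) sequentially"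
      unfolding uniform_limit_iff
    proof safe
      fix e :: real assume "e > 0"
      with unif[of "norm z"] show "\<forall>\<^sub>F n in sequentially. \<forall>s\<in>{a..b}. dist (S n s z) (W s z) < e"
        by (auto simp: uniform_limit_iff S_def W_def elim!: allE[of _ e] eventually_mono)
    qed
    then have u: "uniform_limit {a..x} (\<lambda>n s. z *m (S n s z ** A s)) (\<lambda>s. z *m (W s z ** A s)) sequentially"
      using sub W_cont assms
      by (intro bounded_linear.uniform_limit[OF csc.bounded_linear_right]
          cmm.bounded_uniform_limit uniform_limit_const uniform_limit_on_subset[OF _ sub]
          compact_imp_bounded compact_continuous_image)
        (auto intro: continuous_on_subset)
    have c: "continuous_on {a..x} (\<lambda>s. z *m (S n s z ** A s))" for n
      using continuous_on_subset[OF _ sub] assms S_cont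
      by (intro csc.continuous_on cmm.continuous_on continuous_on_const) blast+
    obtain I J where IJ: "\<And>n. ((\<lambda>s. z *m (S n s z ** A s)) has_integral I n) {a..x}"
      "((\<lambda>s. z *m (W s z ** A s)) has_integral J) {a..x}" "I \<longlonglongrightarrow> J"
      using uniform_limit_integral[OF u c] by auto
    have "I n = S (Suc n) x z - mat 1" for n
    proof -
      have "((\<lambda>s. z *m (S n s z ** A s)) has_integral (S (Suc n) x z - S (Suc n) a z)) {a..x}"
        by (rule fundamental_theorem_of_calculus)
          (use x in \<open>auto intro!: has_vector_derivative_within_subset[OF S_deriv]\<close>)
      moreover have "S (Suc n) a z = mat 1"
        by (induction n) (simp_all add: S_def w_def csc.zero_right cscale_one)
      ultimately show ?thesis
        using has_integral_unique[OF IJ(1)] by metis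
    qed
    moreover have "(\<lambda>n. S (Suc n) x z - mat 1) \<longlonglongrightarrow> W x z - mat 1"
      using LIMSEQ_Suc[OF sums[OF x, of z, unfolded sums_def]] unfolding S_def
      by (intro tendsto_diff tendsto_const)
    ultimately have "J = W x z - mat 1"
      using IJ(3) LIMSEQ_unique by (metis (no_types, lifting) ext)
    with IJ(2) show ?thesis
      by (auto simp: integral_unique)
  qed
  show thesis
  proof (rule that)
    show "W a z = mat 1" for z
    proof (cases "a \<le> b")
      case True
      then show ?thesis
        using W_int[of a z] by simp
    qed (simp add: W_def)
    fix x z assume x: "x \<in> {a..b}"
    have "((\<lambda>x. mat 1 + integral {a..x} (\<lambda>s. z *m (W s z ** A s))) has_vector_derivative
        0 + z *m (W x z ** A x)) (at x within {a..b})"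
      by (intro has_vector_derivative_add has_vector_derivative_const integral_has_vector_derivative
          csc.continuous_on continuous_on_const cmm.continuous_on W_cont assms x)
    then show "((\<lambda>x. W x z) has_vector_derivative z *m (W x z ** A x)) (at x within {a..b})"
      using has_vector_derivative_transform[OF x W_int] by simp
  next
    show "entire_mat (W x)" if "x \<in> {a..b}" for x
      using sums[OF that] unfolding w_def by (rule entire_mat_sums)
  qed (rule cont)
qed

text \<open>For traceless \<open>A\<close> the two terms of the product rule cancel. With
  \<open>P = Q\<close> this is conservation of the determinant; for two solutions it gives
  uniqueness.\<close>

lemma traceless_adj2_const:
  fixes P Q A :: "real \<Rightarrow> cmat"
  assumes "is_interval D"
    and "\<And>x. x \<in> D \<Longrightarrow> (P has_vector_derivative P x ** A x) (at x within D)"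
    and "\<And>x. x \<in> D \<Longrightarrow> (Q has_vector_derivative Q x ** A x) (at x within D)"
    and "\<And>x. x \<in> D \<Longrightarrow> A x $ 1 $ 1 + A x $ 2 $ 2 = 0"
    and "x \<in> D" "y \<in> D"
  shows "P x ** adj2 (Q x) = P y ** adj2 (Q y)"
proof -
  have "((\<lambda>x. P x ** adj2 (Q x)) has_vector_derivative 0) (at x within D)" if "x \<in> D" for x
  proof -
    have "((\<lambda>x. adj2 (Q x)) has_vector_derivative adj2 (Q x ** A x)) (at x within D)"
      using assms(3)[OF that] by (rule bounded_linear.has_vector_derivative[OF bounded_linear_adj2])
    from cmm.has_vector_derivative[OF assms(2)[OF that] this]
    have "((\<lambda>x. P x ** adj2 (Q x)) has_vector_derivative
        P x ** adj2 (Q x ** A x) + (P x ** A x) ** adj2 (Q x)) (at x within D)" .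
    moreover have "P x ** adj2 (Q x ** A x) = - ((P x ** A x) ** adj2 (Q x))"
      by (simp add: adj2_mult adj2_traceless[OF assms(4)[OF that]] cmm.minus_left cmm.minus_right matrix_mul_assoc)
    ultimately show ?thesis
      by simp
  qed
  then obtain c where "\<And>x. x \<in> D \<Longrightarrow> P x ** adj2 (Q x) = c"
    using has_vector_derivative_zero_constant[OF is_interval_convex[OF assms(1)]] by blast
  then show ?thesis
    using assms(5,6) by simp
qed

lemma ode_fundamental:
  assumes "continuous_on {a..b} A" "\<And>x. x \<in> {a..b} \<Longrightarrow> A x $ 1 $ 1 + A x $ 2 $ 2 = 0" "0 \<in> {a..b}"
  obtains W where "\<And>z. W 0 z = mat 1"
    "\<And>x z. x \<in> {a..b} \<Longrightarrow>
       ((\<lambda>x. W x z) has_vector_derivative z *m (W x z ** A x)) (at x within {a..b})"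
    "\<And>x. x \<in> {a..b} \<Longrightarrow> entire_mat (W x)"
    "\<And>r. continuous_on ({a..b} \<times> cball 0 r) (\<lambda>(x, z). W x z)"
    "\<And>x z. x \<in> {a..b} \<Longrightarrow> det (W x z) = 1"
    "\<And>x. x \<in> {a..b} \<Longrightarrow> W x 0 = mat 1"
    "\<And>U z. U 0 = mat 1 \<Longrightarrow> (\<And>x. x \<in> {a..b} \<Longrightarrow>
       (U has_vector_derivative z *m (U x ** A x)) (at x within {a..b})) \<Longrightarrow>
       (\<And>x. x \<in> {a..b} \<Longrightarrow> U x = W x z)"
proof -
  obtain Y where Y: "\<And>z. Y a z = mat 1"
    "\<And>x z. x \<in> {a..b} \<Longrightarrow>
       ((\<lambda>x. Y x z) has_vector_derivative z *m (Y x z ** A x)) (at x within {a..b})"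
    "\<And>x. x \<in> {a..b} \<Longrightarrow> entire_mat (Y x)"
    "\<And>r. continuous_on ({a..b} \<times> cball 0 r) (\<lambda>(x, z). Y x z)"
    using ode_series[OF assms(1)] by blast
  \<comment> \<open>The series is normalized at the left end, the data at 0. Left multiplication by
    a matrix constant in \<open>x\<close> keeps the equation, and using the adjugate as inverse
    keeps the dependence on \<open>z\<close> entire.\<close>
  define W where "W x z = adj2 (Y 0 z) ** Y x z" for x z
  have uniq: "P x ** adj2 (Q x) = P y ** adj2 (Q y)"
    if "\<And>x. x \<in> {a..b} \<Longrightarrow> (P has_vector_derivative z *m (P x ** A x)) (at x within {a..b})"
      "\<And>x. x \<in> {a..b} \<Longrightarrow> (Q has_vector_derivative z *m (Q x ** A x)) (at x within {a..b})"
      "x \<in> {a..b}" "y \<in> {a..b}" for P Q x y z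
  proof (rule traceless_adj2_const[of "{a..b}" P "\<lambda>x. z *m A x" Q])
    show "(z *m A x) $ 1 $ 1 + (z *m A x) $ 2 $ 2 = 0" if "x \<in> {a..b}" for x
      using assms(2)[OF that] by (simp flip: distrib_left)
  qed (use that in \<open>simp_all add: cscale_mult_right is_interval_cc\<close>)
  have "a \<in> {a..b}"
    using assms(3) by auto
  then have Y_det: "det (Y x z) = 1" if "x \<in> {a..b}" for x z
    using uniq[OF Y(2)[of _ z] Y(2)[of _ z] that \<open>a \<in> {a..b}\<close>]
    by (intro det_eq_1_of_adj2) (simp add: Y(1))
  have W0: "W 0 z = mat 1" for z
    unfolding W_def by (rule mult_adj2(2)[OF Y_det[OF assms(3)]])
  have W_deriv: "((\<lambda>x. W x z) has_vector_derivative z *m (W x z ** A x)) (at x within {a..b})"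
    if "x \<in> {a..b}" for x z
    unfolding W_def matrix_mul_assoc[symmetric] cscale_mult_right[symmetric]
    using Y(2)[OF that] unfolding cscale_mult_right[symmetric]
    by (rule bounded_linear.has_vector_derivative[OF cmm.bounded_linear_right])
  have W_det: "det (W x z) = 1" if "x \<in> {a..b}" for x z
    using uniq[OF W_deriv[of _ z] W_deriv[of _ z] that assms(3)]
    by (intro det_eq_1_of_adj2) (simp add: W0)
  have W_uniq: "U x = W x z" if "U 0 = mat 1" "\<And>x. x \<in> {a..b} \<Longrightarrow>
       (U has_vector_derivative z *m (U x ** A x)) (at x within {a..b})" "x \<in> {a..b}" for U x z
  proof -
    have "U x ** adj2 (W x z) = mat 1"
      using uniq[OF that(2) W_deriv[of _ z] that(3) assms(3)] by (simp add: W0 that(1))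
    then have "U x ** (adj2 (W x z) ** W x z) = W x z"
      unfolding matrix_mul_assoc by simp
    then show ?thesis
      using mult_adj2[OF W_det[OF that(3)]] by simp
  qed
  show thesis
  proof (rule that[of W])
    show "continuous_on ({a..b} \<times> cball 0 r) (\<lambda>(x, z). W x z)" for r
    proof -
      have "continuous_on ({a..b} \<times> cball 0 r) (\<lambda>p. Y (fst p) (snd p))"
        using Y(4)[of r] by (simp add: case_prod_beta)
      moreover have "continuous_on ({a..b} \<times> cball 0 r) (\<lambda>p. adj2 (Y 0 (snd p)))"
        by (intro bounded_linear.continuous_on[OF bounded_linear_adj2]
            continuous_on_compose2[OF entire_mat_continuous_on[OF Y(3)[OF assms(3)], of UNIV]] continuous_intros) auto
      ultimately show ?thesis
        unfolding W_def case_prod_beta by (intro cmm.continuous_on)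
    qed
    show "entire_mat (W x)" if "x \<in> {a..b}" for x
      unfolding W_def by (intro entire_mat_intros Y(3) that assms(3))
    show "W x 0 = mat 1" if "x \<in> {a..b}" for x
      using W_uniq[of "\<lambda>x. mat 1" 0 x] that by (simp add: csc.zero_left)
  qed (use W0 W_deriv W_det W_uniq in blast)+
qed

subsection \<open>Differentiability of the Birkhoff factors\<close>

lemma has_vector_derivative_iff_quotient:
  "(f has_vector_derivative D) (at x within S) \<longleftrightarrow>
    ((\<lambda>y. (f y - f x) /\<^sub>R (y - x)) \<longlongrightarrow> D) (at x within S)"
proof -
  have "(f has_vector_derivative D) (at x within S) \<longleftrightarrow>
      ((\<lambda>y. (1 / norm (y - x)) *\<^sub>R (f y - (f x + (y - x) *\<^sub>R D))) \<longlongrightarrow> 0) (at x within S)"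
    by (simp add: has_vector_derivative_def has_derivative_within bounded_linear_scaleR_left)
  also have "\<dots> \<longleftrightarrow> ((\<lambda>y. norm ((1 / norm (y - x)) *\<^sub>R (f y - (f x + (y - x) *\<^sub>R D)))) \<longlongrightarrow> 0) (at x within S)"
    by (simp only: tendsto_norm_zero_iff)
  also have "\<dots> \<longleftrightarrow> ((\<lambda>y. norm ((f y - f x) /\<^sub>R (y - x) - D)) \<longlongrightarrow> 0) (at x within S)"
  proof (rule tendsto_cong)
    have "norm ((1 / norm (y - x)) *\<^sub>R (f y - (f x + (y - x) *\<^sub>R D))) = norm ((f y - f x) /\<^sub>R (y - x) - D)"
      if "y \<noteq> x" for y
    proof -
      have "f y - (f x + (y - x) *\<^sub>R D) = (y - x) *\<^sub>R ((f y - f x) /\<^sub>R (y - x) - D)"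
        using that by (simp add: scaleR_diff_right)
      then show ?thesis
        using that by (simp only: norm_scaleR) simp
    qed
    then show "\<forall>\<^sub>F y in at x within S. norm ((1 / norm (y - x)) *\<^sub>R (f y - (f x + (y - x) *\<^sub>R D))) =
        norm ((f y - f x) /\<^sub>R (y - x) - D)"
      by (auto simp: eventually_at_filter)
  qed
  also have "\<dots> \<longleftrightarrow> ((\<lambda>y. (f y - f x) /\<^sub>R (y - x)) \<longlongrightarrow> D) (at x within S)"
    by (simp only: tendsto_norm_zero_iff LIM_zero_iff)
  finally show ?thesis .
qed

text \<open>Uniform continuity of \<open>F'\<close> on the compact product makes its oscillation
  near \<open>x0\<close> at most \<open>e / 2\<close> for all \<open>l\<close> at once; the mean
  value inequality then bounds the remainder.\<close>

lemma uniform_limit_difference_quotient: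
  fixes F :: "real \<Rightarrow> 'a::metric_space \<Rightarrow> 'b::real_normed_vector"
  assumes deriv: "\<And>x l. x \<in> {a..b} \<Longrightarrow> l \<in> K \<Longrightarrow>
      ((\<lambda>x. F x l) has_vector_derivative F' x l) (at x within {a..b})"
    and cont: "continuous_on ({a..b} \<times> K) (\<lambda>(x, l). F' x l)" and "compact K" and "x0 \<in> {a..b}"
  shows "uniform_limit K (\<lambda>x l. (F x l - F x0 l) /\<^sub>R (x - x0)) (F' x0) (at x0 within {a..b})"
  unfolding uniform_limit_iff
proof safe
  fix e :: real assume "e > 0"
  have "uniformly_continuous_on ({a..b} \<times> K) (\<lambda>(x, l). F' x l)"
    using cont \<open>compact K\<close> by (intro compact_uniformly_continuous compact_Times) auto
  then obtain d where d: "d > 0" "\<And>p q. p \<in> {a..b} \<times> K \<Longrightarrow> q \<in> {a..b} \<times> K \<Longrightarrow> dist q p < d \<Longrightarrow>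
      dist ((\<lambda>(x, l). F' x l) q) ((\<lambda>(x, l). F' x l) p) < e / 2"
    using \<open>e > 0\<close> unfolding uniformly_continuous_on_def by (meson half_gt_zero)
  have "norm ((F x l - F x0 l) /\<^sub>R (x - x0) - F' x0 l) < e"
    if "x \<in> {a..b}" "x \<noteq> x0" "dist x x0 < d" "l \<in> K" for x l
  proof -
    define S where "S = {a..b} \<inter> ball x0 d"
    have "norm (F x l - F x0 l - (x - x0) *\<^sub>R F' x0 l) \<le> norm (x - x0) * (e / 2)"
    proof (rule vector_differentiable_bound_linearization)
      show "((\<lambda>x. F x l) has_vector_derivative F' y l) (at y within S)" if "y \<in> S" for y
        using that \<open>l \<in> K\<close> by (intro has_vector_derivative_within_subset[OF deriv]) (auto simp: S_def)
      show "closed_segment x0 x \<subseteq> S"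
        using that \<open>x0 \<in> {a..b}\<close> d(1)
        by (intro closed_segment_subset) (auto simp: S_def dist_commute intro: convex_Int)
      show "norm (F' y l - F' x0 l) \<le> e / 2" if "y \<in> S" for y
        using d(2)[of "(x0, l)" "(y, l)"] that \<open>l \<in> K\<close> \<open>x0 \<in> {a..b}\<close>
        by (auto simp: S_def dist_Pair_Pair dist_commute dist_norm norm_minus_commute)
      show "x0 \<in> S"
        using \<open>x0 \<in> {a..b}\<close> d(1) by (simp add: S_def)
    qed
    moreover have "F x l - F x0 l - (x - x0) *\<^sub>R F' x0 l =
        (x - x0) *\<^sub>R ((F x l - F x0 l) /\<^sub>R (x - x0) - F' x0 l)"
      using that by (simp add: scaleR_diff_right)
    ultimately have "norm (x - x0) * norm ((F x l - F x0 l) /\<^sub>R (x - x0) - F' x0 l) \<le> norm (x - x0) * (e / 2)"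
      by (metis norm_scaleR real_norm_def)
    then have "norm ((F x l - F x0 l) /\<^sub>R (x - x0) - F' x0 l) \<le> e / 2"
      using that by simp
    then show ?thesis
      using \<open>e > 0\<close> by simp
  qed
  then show "\<forall>\<^sub>F x in at x0 within {a..b}. \<forall>l\<in>K. dist ((F x l - F x0 l) /\<^sub>R (x - x0)) (F' x0 l) < e"
    unfolding eventually_at dist_norm[of "_ /\<^sub>R _"] using d(1) by blast
qed

text \<open>The right-hand side of the relation contains \<tau> itself, so the estimate is a
  bootstrap. With \<open>m\<close> the maximum of \<open>norm (\<tau> z - mat 1)\<close> on the disc
  and \<open>N\<close> the norm of the identity, the splitting gives
  \<open>m \<le> 16 * (e * (N + m) * K)\<close>; the smallness condition bounds the part containing
  \<open>m\<close> by \<open>m / 2\<close>, which doubles 16 to 32.\<close>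

lemma birkhoff_perturbation_bound:
  fixes E :: "complex \<Rightarrow> cmat"
  assumes "entire_mat v" "entire_mat \<tau>" "\<tau> 0 = mat 1" "0 < r"
    and eq: "\<And>l. r \<le> norm l \<Longrightarrow> norm l \<le> 2 * r \<Longrightarrow> v l - \<tau> (1 / l) = E l ** \<tau> (1 / l)"
    and E: "\<And>l. r \<le> norm l \<Longrightarrow> norm l \<le> 2 * r \<Longrightarrow> norm (E l) \<le> e"
    and K: "\<And>(P::cmat) (Q::cmat). norm (P ** Q) \<le> norm P * norm Q * K" "K > 0"
    and "32 * K * e \<le> 1" and z: "norm z \<le> 1 / r"
  shows "norm (\<tau> z - mat 1) \<le> 32 * K * e * norm (mat 1 :: cmat)"
proof -
  define N where "N = norm (mat 1 :: cmat)"
  have "e \<ge> 0"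
    using E[of "of_real r"] \<open>0 < r\<close> norm_ge_zero order_trans by (smt (verit) norm_of_real)
  have ent: "entire_mat (\<lambda>l. v l - mat 1)" "entire_mat (\<lambda>z. \<tau> z - mat 1)"
    using assms by (intro entire_mat_intros; simp)+
  have "continuous_on (cball 0 (1 / r)) (\<lambda>z. norm (\<tau> z - mat 1))"
    by (intro continuous_on_norm entire_mat_continuous_on ent)
  moreover have "cball 0 (1 / r) \<noteq> ({} :: complex set)"
    using \<open>0 < r\<close> by simp
  ultimately obtain z1 where z1: "z1 \<in> cball 0 (1 / r)"
    "\<And>z. z \<in> cball 0 (1 / r) \<Longrightarrow> norm (\<tau> z - mat 1) \<le> norm (\<tau> z1 - mat 1)"
    using continuous_attains_sup[of "cball 0 (1 / r)" "\<lambda>z. norm (\<tau> z - mat 1)"] by auto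
  define m where "m = norm (\<tau> z1 - mat 1)"
  have B: "norm ((v l - mat 1) - (\<tau> (1 / l) - mat 1)) \<le> e * (N + m) * K"
    if l: "r \<le> norm l" "norm l \<le> 2 * r" for l
  proof -
    have "norm (1 / l) \<le> 1 / r"
      using l \<open>0 < r\<close> by (simp add: norm_divide frac_le)
    then have "norm (\<tau> (1 / l) - mat 1) \<le> m"
      using z1(2)[of "1 / l"] by (simp add: m_def)
    then have "norm (\<tau> (1 / l)) \<le> N + m"
      using norm_triangle_sub[of "\<tau> (1 / l)" "mat 1"] by (simp add: N_def)
    then have "norm (E l) * norm (\<tau> (1 / l)) * K \<le> e * (N + m) * K"
      using E[OF l] K(2) \<open>e \<ge> 0\<close> by (intro mult_right_mono mult_mono) auto
    then show ?thesis
      using K(1)[of "E l" "\<tau> (1 / l)"] eq[OF l] by simp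
  qed
  have le: "norm (\<tau> z - mat 1) \<le> 16 * (e * (N + m) * K)" if "norm z \<le> 1 / r" for z
    by (rule annulus_split(1)[OF ent _ \<open>0 < r\<close> B that]) (simp_all add: assms(3))
  have "m \<le> 16 * (e * (N + m) * K)"
    using le[of z1] z1(1) by (simp add: m_def)
  moreover have "32 * K * e * m \<le> 1 * m"
    using assms(9) by (intro mult_right_mono) (auto simp: m_def)
  ultimately have "m \<le> 32 * K * e * N"
    by (simp add: algebra_simps)
  then show ?thesis
    using z1(2)[of z] z by (simp add: m_def N_def)
qed

lemma compact_annulus: "compact {l::complex. r \<le> norm l \<and> norm l \<le> 2 * r}"
proof -
  have "{l::complex. r \<le> norm l \<and> norm l \<le> 2 * r} = cball 0 (2 * r) - ball 0 r"
    by auto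
  then show ?thesis
    by (simp add: compact_diff)
qed

text \<open>With \<open>E = P(x0)\<^sup>-\<^sup>1 (F(x) - F(x0)) Q(x0)\<close>, the relative factors \<open>v = P(x0)\<^sup>-\<^sup>1 P(x)\<close> and
  \<open>\<tau> = Q(x0)\<^sup>-\<^sup>1 Q(x)\<close> satisfy \<open>v - \<tau> = E \<tau>\<close>, so to first order \<open>v - 1\<close> and \<open>1 - \<tau>\<close> are
  the two parts of \<open>E\<close> with nonnegative and with negative powers.\<close>

lemma birkhoff_derivative:
  fixes P Q F :: "real \<Rightarrow> complex \<Rightarrow> cmat" and F' ep em :: "complex \<Rightarrow> cmat"
  defines "K \<equiv> \<lambda>r::real. {l::complex. r \<le> norm l \<and> norm l \<le> 2 * r}"
  assumes "x0 \<in> S" "0 < r"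
    and P: "\<And>x. x \<in> S \<Longrightarrow> entire_mat (P x)" and Q: "\<And>x. x \<in> S \<Longrightarrow> entire_mat (Q x)"
    and Q0: "\<And>x. x \<in> S \<Longrightarrow> Q x 0 = mat 1"
    and det: "\<And>z. det (P x0 z) = 1" "\<And>z. det (Q x0 z) = 1"
    and fac: "\<And>x l. x \<in> S \<Longrightarrow> l \<in> K r \<Longrightarrow> F x l ** Q x (1 / l) = P x l"
    and lim: "uniform_limit (K r) (\<lambda>x l. (F x l - F x0 l) /\<^sub>R (x - x0)) F' (at x0 within S)"
    and F': "continuous_on (K r) F'"
    and ep: "entire_mat ep" and em: "entire_mat em" and "em 0 = 0"
    and split: "\<And>l. l \<in> K r \<Longrightarrow> adj2 (P x0 l) ** F' l ** Q x0 (1 / l) = ep l + em (1 / l)"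
  shows "norm z \<le> 1 / r \<Longrightarrow>
      ((\<lambda>x. Q x z) has_vector_derivative - (Q x0 z ** em z)) (at x0 within S)"
    and "norm l \<le> 2 * r \<Longrightarrow>
      ((\<lambda>x. P x l) has_vector_derivative P x0 l ** ep l) (at x0 within S)"
proof -
  define E where "E x l = adj2 (P x0 l) ** (F x l - F x0 l) ** Q x0 (1 / l)" for x l
  define E' where "E' l = adj2 (P x0 l) ** F' l ** Q x0 (1 / l)" for l
  define \<tau> where "\<tau> x z = adj2 (Q x0 z) ** Q x z" for x z
  define v where "v x l = adj2 (P x0 l) ** P x l" for x l
  have inv: "adj2 (P x0 z) ** P x0 z = mat 1" "P x0 z ** adj2 (P x0 z) = mat 1"
    "adj2 (Q x0 z) ** Q x0 z = mat 1" "Q x0 z ** adj2 (Q x0 z) = mat 1" for z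
    using mult_adj2[OF det(1)] mult_adj2[OF det(2)] by auto
  have ent: "entire_mat (v x)" "entire_mat (\<tau> x)" if "x \<in> S" for x
    unfolding v_def \<tau>_def using that \<open>x0 \<in> S\<close> by (intro entire_mat_intros P Q; simp)+
  have \<tau>0: "\<tau> x 0 = mat 1" if "x \<in> S" for x
    using Q0[OF that] Q0[OF \<open>x0 \<in> S\<close>] by (simp add: \<tau>_def)
  have key: "v x l - \<tau> x (1 / l) = E x l ** \<tau> x (1 / l)" if "x \<in> S" "l \<in> K r" for x l
  proof -
    have "Q x0 (1 / l) ** \<tau> x (1 / l) = Q x (1 / l)"
      by (simp add: \<tau>_def matrix_mul_assoc inv)
    then have "E x l ** \<tau> x (1 / l) = adj2 (P x0 l) ** (F x l ** Q x (1 / l) - F x0 l ** Q x (1 / l))"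
      by (simp add: E_def cmm.diff_left flip: matrix_mul_assoc)
    also have "F x0 l ** Q x (1 / l) = (F x0 l ** Q x0 (1 / l)) ** \<tau> x (1 / l)"
      by (simp add: \<tau>_def matrix_mul_assoc flip: matrix_mul_assoc[of _ "Q x0 _"] add: inv)
    also have "\<dots> = P x0 l ** \<tau> x (1 / l)"
      by (simp add: fac[OF \<open>x0 \<in> S\<close> that(2)])
    also have "adj2 (P x0 l) ** (F x l ** Q x (1 / l) - P x0 l ** \<tau> x (1 / l)) = v x l - \<tau> x (1 / l)"
      by (simp add: cmm.diff_right fac[OF that] v_def matrix_mul_assoc inv)
    finally show ?thesis ..
  qed
  have K_compact: "compact (K r)"
    unfolding K_def by (rule compact_annulus)
  have K_inv: "(\<lambda>l. 1 / l) ` K r \<subseteq> cball 0 (1 / r)" "0 \<notin> K r"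
    using \<open>0 < r\<close> by (auto simp: K_def norm_divide frac_le)
  have cont_inv: "continuous_on (K r) (\<lambda>l. R (1 / l))" if "entire_mat R" for R
  proof -
    have "continuous_on (K r) (\<lambda>l. 1 / l :: complex)"
      using K_inv(2) by (intro continuous_intros) auto
    then show ?thesis
      by (rule continuous_on_compose2[OF entire_mat_continuous_on[OF that, of UNIV]]) simp
  qed
  have contPF: "continuous_on (K r) (\<lambda>l. adj2 (P x0 l))" "continuous_on (K r) (\<lambda>l. adj2 (P x0 l) ** F' l)"
    by (intro entire_mat_continuous_on entire_mat_intros P \<open>x0 \<in> S\<close> cmm.continuous_on F')+
  have contE': "continuous_on (K r) E'"
    unfolding E'_def by (intro contPF cmm.continuous_on[OF contPF(2)] cont_inv Q \<open>x0 \<in> S\<close>)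
  have bdd: "bounded (f ` K r)" if "continuous_on (K r) f" for f :: "complex \<Rightarrow> cmat"
    using that by (intro compact_imp_bounded compact_continuous_image K_compact)
  have E'_eq: "E' l = ep l + em (1 / l)" if "l \<in> K r" for l
    using split[OF that] by (simp add: E'_def)
  have limE: "uniform_limit (K r) (\<lambda>x l. E x l /\<^sub>R (x - x0)) E' (at x0 within S)"
  proof -
    have "uniform_limit (K r) (\<lambda>x l. adj2 (P x0 l) ** ((F x l - F x0 l) /\<^sub>R (x - x0)) ** Q x0 (1 / l))
        (\<lambda>l. adj2 (P x0 l) ** F' l ** Q x0 (1 / l)) (at x0 within S)"
      by (intro cmm.bounded_uniform_limit uniform_limit_const lim bdd contPF F' cont_inv Q \<open>x0 \<in> S\<close>)
    then show ?thesis
      by (simp add: E_def E'_def[abs_def] cmm.scaleR_left cmm.scaleR_right)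
  qed
  obtain k where k: "\<And>(P::cmat) (Q::cmat). norm (P ** Q) \<le> norm P * norm Q * k" "k > 0"
    using cmm.pos_bounded by metis
  have near: "\<forall>\<^sub>F x in at x0 within S. x \<in> S \<and> x \<noteq> x0"
    by (simp add: eventually_at_filter)
  have E_small: "\<forall>\<^sub>F x in at x0 within S. \<forall>l\<in>K r. norm (E x l) < e" if "e > 0" for e
  proof -
    have "((\<lambda>x. x - x0) \<longlongrightarrow> x0 - x0) (at x0 within S)"
      by (intro tendsto_intros)
    then have "uniform_limit (K r) (\<lambda>x l. x - x0) (\<lambda>l. 0) (at x0 within S)"
      by (auto simp: uniform_limit_iff tendsto_iff elim!: eventually_mono)
    then have "uniform_limit (K r) (\<lambda>x l. (x - x0) *\<^sub>R (E x l /\<^sub>R (x - x0))) (\<lambda>l. 0 *\<^sub>R E' l) (at x0 within S)"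
      by (intro bounded_bilinear.bounded_uniform_limit[OF bounded_bilinear_scaleR] limE bdd contE')
        (auto intro: bounded_subset[of "{0}"])
    then have "\<forall>\<^sub>F x in at x0 within S. \<forall>l\<in>K r. norm ((x - x0) *\<^sub>R (E x l /\<^sub>R (x - x0))) < e"
      using that by (simp add: uniform_limit_iff)
    with near show ?thesis
      by eventually_elim simp
  qed
  \<comment> \<open>Continuity of \<tau> comes before its differentiability: it allows the factor
    \<tau> in \<open>v - \<tau> = E \<tau>\<close> to be replaced by the identity in the
    limit.\<close>
  have lim\<tau>: "uniform_limit (K r) (\<lambda>x l. \<tau> x (1 / l)) (\<lambda>l. mat 1) (at x0 within S)"
    unfolding uniform_limit_iff
  proof safe
    fix e :: real assume "e > 0"
    define N where "N = norm (mat 1 :: cmat) + 1"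
    \<comment> \<open>The first bound admits the bootstrap, the second makes its outcome less than
      \<open>e\<close>; strictness comes from \<open>N\<close> exceeding the norm of the
      identity.\<close>
    define d where "d = min (1 / (32 * k)) (e / (32 * k * N))"
    have N: "N > 0" "norm (mat 1 :: cmat) < N"
      by (simp_all add: N_def add_nonneg_pos)
    have d: "d > 0" "32 * k * d \<le> 1"
      using k \<open>e > 0\<close> N by (auto simp: d_def field_simps min_def)
    have "32 * k * d * norm (mat 1 :: cmat) < 32 * k * d * N"
      using k d N by (intro mult_strict_left_mono) auto
    also have "\<dots> \<le> 32 * k * (e / (32 * k * N)) * N"
      using k N by (intro mult_right_mono mult_left_mono) (auto simp: d_def)
    also have "\<dots> = e"
      using k N by simp
    finally have de: "32 * k * d * norm (mat 1 :: cmat) < e" .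
    show "\<forall>\<^sub>F x in at x0 within S. \<forall>l\<in>K r. dist (\<tau> x (1 / l)) (mat 1) < e"
      using near E_small[OF d(1)]
    proof eventually_elim
      case (elim x)
      have "norm (\<tau> x (1 / l) - mat 1) \<le> 32 * k * d * norm (mat 1 :: cmat)" if "l \<in> K r" for l
        by (rule birkhoff_perturbation_bound[OF ent[of x] \<tau>0[of x] \<open>0 < r\<close> key _ k d(2)])
          (use elim that K_inv(1) in \<open>auto simp: K_def less_imp_le\<close>)
      with de show ?case
        by (force simp: dist_norm)
    qed
  qed
  have limR: "uniform_limit (K r) (\<lambda>x l. (E x l /\<^sub>R (x - x0)) ** \<tau> x (1 / l)) (\<lambda>l. E' l ** mat 1) (at x0 within S)"
    by (intro cmm.bounded_uniform_limit limE lim\<tau> bdd contE' continuous_on_const)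
  \<comment> \<open>Errors of the two difference quotients. The signs make
    \<open>p x l - q x (1 / l)\<close> the error for \<open>v - \<tau>\<close>, and
    \<open>q x\<close> vanishes at 0, so the splitting applies again.\<close>
  define p where "p x l = (v x l - mat 1) /\<^sub>R (x - x0) - ep l" for x l
  define q where "q x z = (\<tau> x z - mat 1) /\<^sub>R (x - x0) + em z" for x z
  have quot: "\<forall>\<^sub>F x in at x0 within S. (norm z \<le> 1 / r \<longrightarrow> norm (q x z) < e) \<and> (norm l \<le> 2 * r \<longrightarrow> norm (p x l) < e)"
    if "e > 0" for e z l
  proof -
    \<comment> \<open>The splitting costs a factor of at most 20, and 20/21 of \<open>e\<close> is
      strictly below \<open>e\<close>.\<close>
    have "\<forall>\<^sub>F x in at x0 within S. \<forall>l\<in>K r. norm ((E x l /\<^sub>R (x - x0)) ** \<tau> x (1 / l) - E' l) < e / 21"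
      using uniform_limitD[OF limR, of "e / 21"] \<open>e > 0\<close> unfolding dist_norm matrix_mul_rid by simp
    with near show ?thesis
    proof eventually_elim
      case (elim x)
      have ent_pq: "entire_mat (p x)" "entire_mat (q x)" and q0: "q x 0 = 0"
        unfolding p_def q_def using elim by (auto intro!: entire_mat_intros ent ep em simp: \<tau>0 \<open>em 0 = 0\<close>)
      have "norm (p x l - q x (1 / l)) \<le> e / 21" if "r \<le> norm l" "norm l \<le> 2 * r" for l
      proof -
        have l: "l \<in> K r"
          using that by (simp add: K_def)
        have "p x l - q x (1 / l) = (v x l - \<tau> x (1 / l)) /\<^sub>R (x - x0) - E' l"
          by (simp add: p_def q_def E'_eq[OF l] algebra_simps)
        also have "\<dots> = (E x l /\<^sub>R (x - x0)) ** \<tau> x (1 / l) - E' l"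
          using key[of x l] elim l by (simp add: cmm.scaleR_left)
        finally show ?thesis
          using elim l by (auto intro: less_imp_le)
      qed
      from annulus_split[OF ent_pq q0 \<open>0 < r\<close> this] show ?case
        using \<open>e > 0\<close> by fastforce
    qed
  qed
  show "((\<lambda>x. Q x z) has_vector_derivative - (Q x0 z ** em z)) (at x0 within S)" if "norm z \<le> 1 / r"
  proof -
    have "((\<lambda>x. q x z - em z) \<longlongrightarrow> 0 - em z) (at x0 within S)"
      using quot[of _ z 0] that by (intro tendsto_diff tendsto_const) (simp add: tendsto_iff eventually_conj_iff)
    then have "((\<lambda>x. \<tau> x z) has_vector_derivative - em z) (at x0 within S)"
      unfolding has_vector_derivative_iff_quotient by (simp add: q_def \<tau>_def inv)
    from bounded_linear.has_vector_derivative[OF cmm.bounded_linear_right[of "Q x0 z"] this]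
    show ?thesis
      by (simp add: \<tau>_def matrix_mul_assoc inv cmm.minus_right)
  qed
  show "((\<lambda>x. P x l) has_vector_derivative P x0 l ** ep l) (at x0 within S)" if "norm l \<le> 2 * r"
  proof -
    have "((\<lambda>x. p x l + ep l) \<longlongrightarrow> 0 + ep l) (at x0 within S)"
      using quot[of _ 0 l] that by (intro tendsto_add tendsto_const) (simp add: tendsto_iff eventually_conj_iff)
    then have "((\<lambda>x. v x l) has_vector_derivative ep l) (at x0 within S)"
      unfolding has_vector_derivative_iff_quotient by (simp add: p_def v_def inv)
    from bounded_linear.has_vector_derivative[OF cmm.bounded_linear_right[of "P x0 l"] this]
    show ?thesis
      by (simp add: v_def matrix_mul_assoc inv)
  qed
qed

subsection \<open>Derivatives in the two directions\<close>

text \<open>On each side the compact interval ends at a point of \<open>D\<close> beyond both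
  \<open>u\<close> and \<open>x\<close> or, if there is none, at the extreme point of
  \<open>D\<close> itself. Near \<open>x\<close> nothing of \<open>D\<close> is cut off, so
  derivatives within the two sets agree.\<close>

lemma compact_subinterval:
  fixes D :: "real set"
  assumes "is_interval D" "u \<in> D" "x \<in> D"
  obtains a b where "{a..b} \<subseteq> D" "u \<in> {a..b}" "x \<in> {a..b}" "at x within D = at x within {a..b}"
proof -
  have "\<exists>b\<in>D. max x u \<le> b \<and> (\<forall>y\<in>D. y \<le> max x u \<or> max x u < b)"
  proof (cases "\<exists>y\<in>D. y > max x u")
    case False
    then show ?thesis
      using assms by (intro bexI[of _ "max x u"]) (auto simp: max_def not_less)
  qed (auto intro: less_imp_le)
  then obtain b where b: "b \<in> D" "max x u \<le> b" "\<forall>y\<in>D. y \<le> max x u \<or> max x u < b"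
    by blast
  have "\<exists>a\<in>D. a \<le> min x u \<and> (\<forall>y\<in>D. min x u \<le> y \<or> a < min x u)"
  proof (cases "\<exists>y\<in>D. y < min x u")
    case False
    then show ?thesis
      using assms by (intro bexI[of _ "min x u"]) (auto simp: min_def not_less)
  qed (auto intro: less_imp_le)
  then obtain a where a: "a \<in> D" "a \<le> min x u" "\<forall>y\<in>D. min x u \<le> y \<or> a < min x u"
    by blast
  \<comment> \<open>The offset 1 is arbitrary: it occurs on a side where \<open>D\<close> has no
    points beyond \<open>u\<close> and \<open>x\<close>.\<close>
  define S where "S = {(if a < min x u then a else x - 1)<..<(if max x u < b then b else x + 1)}"
  have sub: "{a..b} \<subseteq> D"
    using assms(1) a(1) b(1) unfolding is_interval_1 by fastforce
  have "at x within D = at x within {a..b}"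
  proof (rule at_within_nhd)
    show "x \<in> S" "open S"
      using a b by (auto simp: S_def)
    have "y \<in> {a..b}" if "y \<in> D" "y \<in> S" for y
    proof -
      have "y \<le> b"
      proof (cases "max x u < b")
        case True
        with that(2) show ?thesis
          by (simp add: S_def)
      next
        case False
        with b(3) that(1) have "y \<le> max x u"
          by blast
        with b(2) show ?thesis
          by (rule order_trans[rotated])
      qed
      moreover have "a \<le> y"
      proof (cases "a < min x u")
        case True
        with that(2) show ?thesis
          by (simp add: S_def)
      next
        case False
        with a(3) that(1) have "min x u \<le> y"
          by blast
        with a(2) show ?thesis
          by (rule order_trans)
      qed
      ultimately show ?thesis
        by simp
    qed
    with sub show "D \<inter> S - {x} = {a..b} \<inter> S - {x}"
      by blast
  qed
  moreover have "u \<in> {a..b}" "x \<in> {a..b}"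
    using a(2) b(2) by simp_all
  ultimately show thesis
    using sub that by blast
qed

text \<open>By continuity \<open>\<psi> s\<close> stays within \<open>pi\<close> of
  \<open>\<psi> x\<close> near \<open>x\<close>. There the principal logarithm of
  \<open>f s / f x\<close> is \<open>\<i> * (\<psi> x - \<psi> s) / 2\<close>, which expresses
  \<psi> through a differentiable function of \<open>f\<close>.\<close>

lemma has_real_derivative_of_exp:
  fixes \<psi> :: "real \<Rightarrow> real" and f :: "real \<Rightarrow> complex"
  assumes "x \<in> S" "continuous (at x within S) \<psi>"
    and f: "\<And>s. s \<in> S \<Longrightarrow> f s = exp (- \<i> * of_real (\<psi> s) / 2)"
    and deriv: "(f has_vector_derivative - (\<i> / 2 * of_real p * f x)) (at x within S)"
  shows "(\<psi> has_real_derivative p) (at x within S)"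
proof -
  have fx: "f x \<noteq> 0"
    by (simp add: f[OF \<open>x \<in> S\<close>])
  have "((\<lambda>s. f s / f x) has_vector_derivative - (\<i> / 2 * of_real p * f x) / f x) (at x within S)"
    using deriv by (rule has_vector_derivative_divide)
  then have q: "((\<lambda>s. f s / f x) has_vector_derivative - (\<i> / 2 * of_real p)) (at x within S)"
    using fx by simp
  have "(Ln has_field_derivative inverse 1) (at (f x / f x) within (\<lambda>s. f s / f x) ` S)"
    using fx has_field_derivative_Ln[of 1] by (auto intro: has_field_derivative_at_within)
  from field_vector_diff_chain_within[OF q this]
  have "((\<lambda>s. Ln (f s / f x)) has_vector_derivative - (\<i> / 2 * of_real p)) (at x within S)"
    by (simp add: o_def)
  from bounded_linear.has_vector_derivative[OF bounded_linear_Im this]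
  have "((\<lambda>s. Im (Ln (f s / f x))) has_vector_derivative - p / 2) (at x within S)"
    by simp
  then have "((\<lambda>s. Im (Ln (f s / f x))) has_real_derivative - p / 2) (at x within S)"
    by (simp add: has_real_derivative_iff_has_vector_derivative)
  from DERIV_diff[OF DERIV_const DERIV_cmult[OF this, of 2], of "\<psi> x"]
  have "((\<lambda>s. \<psi> x - 2 * Im (Ln (f s / f x))) has_real_derivative p) (at x within S)"
    by simp
  moreover have "\<forall>\<^sub>F s in at x within S. \<psi> x - 2 * Im (Ln (f s / f x)) = \<psi> s"
  proof -
    have "\<forall>\<^sub>F s in at x within S. dist (\<psi> s) (\<psi> x) < pi"
      using assms(2) pi_gt_zero by (auto simp: continuous_within tendsto_iff)
    moreover have "\<forall>\<^sub>F s in at x within S. s \<in> S"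
      by (simp add: eventually_at_filter)
    ultimately show ?thesis
    proof eventually_elim
      case (elim s)
      have "f s / f x = exp (\<i> * of_real ((\<psi> x - \<psi> s) / 2))"
        by (simp add: f elim \<open>x \<in> S\<close> exp_diff[symmetric] algebra_simps diff_divide_distrib)
      moreover have "Ln (exp (\<i> * of_real ((\<psi> x - \<psi> s) / 2))) = \<i> * of_real ((\<psi> x - \<psi> s) / 2)"
        using elim by (intro Ln_exp) (auto simp: dist_real_def)
      ultimately have "Ln (f s / f x) = \<i> * of_real ((\<psi> x - \<psi> s) / 2)"
        by (simp only:)
      then have "Im (Ln (f s / f x)) = (\<psi> x - \<psi> s) / 2"
        by (simp only: Im_i_times Re_complex_of_real)
      then show ?case
        by simp
    qed
  qed
  moreover have "\<psi> x - 2 * Im (Ln (f x / f x)) = \<psi> x"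
    using fx by simp
  ultimately show ?thesis
    using has_field_derivative_cong_eventually[of "\<lambda>s. \<psi> x - 2 * Im (Ln (f s / f x))" \<psi> x S p] by blast
qed

lemma has_left_log_derivative_mult:
  assumes "has_left_log_derivative W M x D"
  shows "(W has_vector_derivative W x ** M) (at x within D)"
proof -
  obtain W' where W': "invertible (W x)" "(W has_vector_derivative W') (at x within D)"
    "matrix_inv (W x) ** W' = M"
    using assms by (auto simp: has_left_log_derivative_def)
  obtain B where "W x ** B = mat 1" "B ** W x = mat 1"
    using W'(1) by (auto simp: invertible_def)
  then have "W x ** matrix_inv (W x) = mat 1"
    using matrix_inv_unique by metis
  then have "W x ** M = W'"
    unfolding W'(3)[symmetric] matrix_mul_assoc by simp
  with W'(2) show ?thesis
    by simp
qed

text \<open>Both sides are holomorphic on the punctured plane, which is connected. This carries the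
  Birkhoff factorization from real \<lambda> to the complex annuli.\<close>

lemma laurent_eq_from_reals:
  assumes ent: "entire_mat A" "entire_mat B" "entire_mat C" "entire_mat P"
    and eq: "\<And>l::real. l \<noteq> 0 \<Longrightarrow> A (1 / of_real l) ** B (of_real l) ** C (1 / of_real l) = P (of_real l)"
    and "l \<noteq> 0"
  shows "A (1 / l) ** B l ** C (1 / l) = P l"
proof -
  have inv: "(\<lambda>l. R (1 / l) $ i $ j) holomorphic_on - {0}" if "entire_mat R" for R i j
  proof -
    have "(\<lambda>l::complex. 1 / l) holomorphic_on - {0}"
      by (intro holomorphic_intros) auto
    from holomorphic_on_compose_gen[OF this, of "\<lambda>z. R z $ i $ j" UNIV] that show ?thesis
      by (simp add: entire_mat_def o_def)
  qed
  have pos: "(\<lambda>l. R l $ i $ j) holomorphic_on - {0}" if "entire_mat R" for R i j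
    using that holomorphic_on_subset by (fastforce simp: entire_mat_def)
  have "(A (1 / l) ** B l ** C (1 / l)) $ i $ j = P l $ i $ j" for i j
  proof (rule analytic_eq_from_reals[of "\<lambda>l. (A (1 / l) ** B l ** C (1 / l)) $ i $ j" "- {0}" "\<lambda>l. P l $ i $ j"])
    show "(\<lambda>l. (A (1 / l) ** B l ** C (1 / l)) $ i $ j) holomorphic_on - {0}"
      unfolding cmat_mult_nth by (intro holomorphic_intros inv pos ent)
    show "connected (- {0::complex})"
      by (intro connected_punctured_universe) simp
  qed (use eq \<open>l \<noteq> 0\<close> in \<open>auto intro!: pos ent simp del: cmat_mult_nth\<close>)
  then show ?thesis
    by (simp add: vec_eq_iff del: cmat_mult_nth)
qed

text \<open>The Maurer--Cartan form in the plus direction: only the terms of degree at least 0 in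
  \<open>l\<close> of the conjugated potential survive, and the twisting condition makes the degree 0 term
  diagonal.\<close>

lemma x_derivative:
  fixes W P Q :: "real \<Rightarrow> complex \<Rightarrow> cmat" and C :: "complex \<Rightarrow> cmat"
  assumes x0: "x0 \<in> {a..b}"
    and W: "\<And>x z. x \<in> {a..b} \<Longrightarrow>
       ((\<lambda>x. W x z) has_vector_derivative
         z *m (W x z ** mat2 0 (\<i> / 2 * exp (- \<i> * of_real (\<alpha> x))) (\<i> / 2 * exp (\<i> * of_real (\<alpha> x))) 0))
       (at x within {a..b})"
    and W_cont: "\<And>r. continuous_on ({a..b} \<times> cball 0 r) (\<lambda>(x, z). W x z)"
    and \<alpha>: "\<And>x. x \<in> {a..b} \<Longrightarrow> (\<alpha> has_real_derivative \<alpha>' x) (at x within {a..b})"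
    and \<alpha>': "continuous_on {a..b} \<alpha>'"
    and V0: "V0 = (\<lambda>x. mat2 (exp (- \<i> * of_real (\<alpha> x) / 2)) 0 0 (exp (\<i> * of_real (\<alpha> x) / 2)))"
    and C: "entire_mat C"
    and P: "\<And>x. x \<in> {a..b} \<Longrightarrow> entire_mat (P x)" and Q: "\<And>x. x \<in> {a..b} \<Longrightarrow> entire_mat (Q x)"
    and Q0: "\<And>x. x \<in> {a..b} \<Longrightarrow> Q x 0 = mat 1"
    and det: "\<And>z. det (P x0 z) = 1" "\<And>z. det (Q x0 z) = 1"
    and SU2: "\<And>l::real. l \<noteq> 0 \<Longrightarrow> Q x0 (of_real l) \<in> SU2"
    and twist: "\<And>l::real. l \<noteq> 0 \<Longrightarrow> Q x0 (- of_real l) $ 1 $ 1 = Q x0 (of_real l) $ 1 $ 1"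
    and fac: "\<And>x l. x \<in> {a..b} \<Longrightarrow> l \<noteq> 0 \<Longrightarrow> C (1 / l) ** (W x l ** V0 x) ** Q x (1 / l) = P x l"
  obtains p :: real where "\<And>l. ((\<lambda>x. P x l) has_vector_derivative
      P x0 l ** ((\<i> / 2) *m mat2 (- of_real p) l l (of_real p))) (at x0 within {a..b})"
proof -
  define A where "A x = mat2 0 (\<i> / 2 * exp (- \<i> * of_real (\<alpha> x))) (\<i> / 2 * exp (\<i> * of_real (\<alpha> x))) 0" for x
  define M1 where "M1 = mat2 0 (\<i> / 2) (\<i> / 2) 0"
  define M0 where "M0 x = mat2 (- \<i> * of_real (\<alpha>' x) / 2) 0 0 (\<i> * of_real (\<alpha>' x) / 2)" for x
  \<comment> \<open>Conjugation by \<open>V0\<close> removes \<alpha> from the potential and leaves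
    the constant \<open>M1\<close>; the derivative of \<open>V0\<close> contributes the diagonal
    term \<open>M0\<close>.\<close>
  have AV0: "A x ** V0 x = V0 x ** M1" for x
  proof -
    have "exp (- \<i> * of_real (\<alpha> x)) * exp (\<i> * of_real (\<alpha> x) / 2) = exp (- \<i> * of_real (\<alpha> x) / 2)"
      "exp (\<i> * of_real (\<alpha> x)) * exp (- \<i> * of_real (\<alpha> x) / 2) = exp (\<i> * of_real (\<alpha> x) / 2)"
      unfolding exp_add[symmetric] by (simp_all add: field_simps)
    then show ?thesis
      by (simp add: cmat_eq_iff A_def V0 M1_def)
  qed
  have V0_deriv: "(V0 has_vector_derivative V0 x ** M0 x) (at x within {a..b})" if "x \<in> {a..b}" for x
  proof -
    have "((\<lambda>x. exp (c * of_real (\<alpha> x) / 2)) has_vector_derivative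
        exp (c * of_real (\<alpha> x) / 2) * (c * of_real (\<alpha>' x) / 2)) (at x within {a..b})" for c :: complex
    proof -
      have "((\<lambda>x. complex_of_real (\<alpha> x)) has_vector_derivative of_real (\<alpha>' x)) (at x within {a..b})"
        using \<alpha>[OF that] by (intro has_vector_derivative_of_real) (simp add: has_real_derivative_iff_has_vector_derivative)
      then have "((\<lambda>x. c / 2 * complex_of_real (\<alpha> x)) has_vector_derivative c / 2 * of_real (\<alpha>' x)) (at x within {a..b})"
        by (rule has_vector_derivative_mult_right)
      from field_vector_diff_chain_within[OF this has_field_derivative_at_within[OF DERIV_exp]]
      show ?thesis
        by (simp add: o_def mult_ac)
    qed
    note e = this[of "- \<i>"] this[of \<i>]
    have lin: "bounded_linear (\<lambda>c. mat2 c 0 0 0)" "bounded_linear (\<lambda>c. mat2 0 0 0 c)"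
      by (intro linear_conv_bounded_linear[THEN iffD1] linearI; simp add: cmat_eq_iff)+
    have "V0 = (\<lambda>x. mat2 (exp (- \<i> * of_real (\<alpha> x) / 2)) 0 0 0 + mat2 0 0 0 (exp (\<i> * of_real (\<alpha> x) / 2)))"
      by (simp add: V0 fun_eq_iff cmat_eq_iff)
    moreover have "V0 x ** M0 x = mat2 (exp (- \<i> * of_real (\<alpha> x) / 2) * (- \<i> * of_real (\<alpha>' x) / 2)) 0 0 0 +
        mat2 0 0 0 (exp (\<i> * of_real (\<alpha> x) / 2) * (\<i> * of_real (\<alpha>' x) / 2))"
      by (simp add: V0 M0_def cmat_eq_iff)
    ultimately show ?thesis
      using has_vector_derivative_add[OF bounded_linear.has_vector_derivative[OF lin(1) e(1)]
          bounded_linear.has_vector_derivative[OF lin(2) e(2)]] by simp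
  qed
  define F where "F x l = C (1 / l) ** (W x l ** V0 x)" for x l
  define F' where "F' x l = C (1 / l) ** (W x l ** V0 x ** (l *m M1 + M0 x))" for x l
  have F_deriv: "((\<lambda>x. F x l) has_vector_derivative F' x l) (at x within {a..b})" if "x \<in> {a..b}" for x l
  proof -
    have "((\<lambda>x. W x l ** V0 x) has_vector_derivative W x l ** (V0 x ** M0 x) + (l *m (W x l ** A x)) ** V0 x)
        (at x within {a..b})"
      using cmm.has_vector_derivative[OF W[OF that] V0_deriv[OF that]] unfolding A_def .
    moreover have "(l *m (W x l ** A x)) ** V0 x = W x l ** V0 x ** (l *m M1)"
      by (simp add: cscale_mult_left cscale_mult_right AV0 flip: matrix_mul_assoc)
    ultimately have "((\<lambda>x. W x l ** V0 x) has_vector_derivative W x l ** V0 x ** (l *m M1 + M0 x))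
        (at x within {a..b})"
      by (simp add: cmm.add_right matrix_mul_assoc add.commute)
    then show ?thesis
      unfolding F_def F'_def by (rule bounded_linear.has_vector_derivative[OF cmm.bounded_linear_right])
  qed
  have V0_cont: "continuous_on {a..b} V0"
    using V0_deriv has_vector_derivative_continuous continuous_on_eq_continuous_within by blast
  have M0_cont: "continuous_on {a..b} M0"
  proof -
    have "bounded_linear (\<lambda>t::real. mat2 (- \<i> * of_real t / 2) 0 0 (\<i> * of_real t / 2))"
      by (intro linear_conv_bounded_linear[THEN iffD1] linearI)
        (simp_all add: cmat_eq_iff scaleR_conv_of_real[where 'a=complex] field_simps)
    from bounded_linear.continuous_on[OF this \<alpha>'] show ?thesis
      by (simp add: M0_def[abs_def])
  qed
  obtain Q1 where Q1: "entire_mat Q1" "\<And>z. Q x0 z = mat 1 + z *m Q1 z"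
    using entire_mat_factor[OF Q[OF x0]] Q0[OF x0] by metis
  obtain \<beta> where \<beta>: "Q1 0 = mat2 0 \<beta> (- cnj \<beta>) 0"
    using twisted_linear_coeff[OF Q1 SU2 twist] by blast
  \<comment> \<open>The linear coefficient of \<open>Q\<close> contributes
    \<open>\<beta> + cnj \<beta>\<close> to the diagonal term of degree 0, hence a real number. Here
    \<beta> is a complex coefficient, not the given function.\<close>
  define p where "p = \<alpha>' x0 + 2 * Re \<beta>"
  define ep where "ep l = (\<i> / 2) *m mat2 (- of_real p) l l (of_real p)" for l
  \<comment> \<open>Collects all terms of positive degree in \<open>z = 1 / l\<close>; subtracting
    the values at 0 gives \<open>em 0 = 0\<close>.\<close>
  define em where "em z = (adj2 (Q1 z) ** M1 + M1 ** Q1 z - (adj2 (Q1 0) ** M1 + M1 ** Q1 0)) +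
    z *m (adj2 (Q1 z) ** M1 ** Q1 z) + (adj2 (Q x0 z) ** M0 x0 ** Q x0 z - M0 x0)" for z
  have ep: "ep l = l *m M1 + M0 x0 + (adj2 (Q1 0) ** M1 + M1 ** Q1 0)" for l
  proof -
    have "2 * complex_of_real (Re \<beta>) = \<beta> + cnj \<beta>"
      by (simp add: complex_add_cnj)
    then have "complex_of_real p = of_real (\<alpha>' x0) + (\<beta> + cnj \<beta>)"
      by (simp add: p_def)
    then show ?thesis
      by (simp add: ep_def \<beta> M1_def M0_def cmat_eq_iff algebra_simps diff_divide_distrib add_divide_distrib)
  qed
  have split: "adj2 (Q x0 (1 / l)) ** (l *m M1 + M0 x0) ** Q x0 (1 / l) = ep l + em (1 / l)" if "l \<noteq> 0" for l
  proof -
    define z where "z = 1 / l"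
    have lz: "l * z = 1"
      using that by (simp add: z_def)
    have "l *m (adj2 (Q x0 z) ** M1 ** Q x0 z) = l *m M1 + (l * z) *m (adj2 (Q1 z) ** M1 + M1 ** Q1 z) +
        (l * z) *m (z *m (adj2 (Q1 z) ** M1 ** Q1 z))"
      by (simp add: Q1(2) adj2_add adj2_cscale cmm.add_left cmm.add_right csc.add_right
          cscale_mult_left cscale_mult_right cscale_cscale mult_ac)
    then have "l *m (adj2 (Q x0 z) ** M1 ** Q x0 z) = l *m M1 + (adj2 (Q1 z) ** M1 + M1 ** Q1 z) +
        z *m (adj2 (Q1 z) ** M1 ** Q1 z)"
      by (simp add: lz cscale_one)
    moreover have "adj2 (Q x0 z) ** (l *m M1 + M0 x0) ** Q x0 z =
        l *m (adj2 (Q x0 z) ** M1 ** Q x0 z) + adj2 (Q x0 z) ** M0 x0 ** Q x0 z"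
      by (simp add: cmm.add_left cmm.add_right cscale_mult_left cscale_mult_right)
    ultimately show ?thesis
      unfolding z_def[symmetric] ep em_def by (simp add: algebra_simps)
  qed
  have ent: "entire_mat ep" "entire_mat em" and em0: "em 0 = 0"
  proof -
    show "entire_mat ep"
      unfolding ep[abs_def] by (intro entire_mat_intros holomorphic_intros)
    show "entire_mat em"
      unfolding em_def by (intro entire_mat_intros Q1 Q x0 holomorphic_intros)
    show "em 0 = 0"
      by (simp add: em_def csc.zero_left Q0[OF x0])
  qed
  have "((\<lambda>x. P x l) has_vector_derivative P x0 l ** ep l) (at x0 within {a..b})" for l
  proof -
    \<comment> \<open>The annulus depends on \<open>l\<close>, which has to lie in the disc of
      radius \<open>2 * r\<close> where the derivative of \<open>P\<close> is obtained.\<close>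
    define r where "r = norm l + 1"
    define K where "K = {l::complex. r \<le> norm l \<and> norm l \<le> 2 * r}"
    have r: "0 < r" "norm l \<le> 2 * r"
      using norm_ge_zero[of l] by (auto simp: r_def simp del: norm_ge_zero)
    have K0: "l \<noteq> 0" if "l \<in> K" for l
      using that r by (auto simp: K_def)
    have cont: "continuous_on ({a..b} \<times> K) (\<lambda>(x, l). F' x l)"
    proof -
      have "continuous_on ({a..b} \<times> K) (\<lambda>p. W (fst p) (snd p))"
        by (rule continuous_on_subset[OF W_cont[of "2 * r", unfolded case_prod_beta]]) (auto simp: K_def)
      moreover have "continuous_on ({a..b} \<times> K) (\<lambda>p. 1 / snd p)"
        using K0 by (intro continuous_intros) auto
      then have "continuous_on ({a..b} \<times> K) (\<lambda>p. C (1 / snd p))"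
        by (rule continuous_on_compose2[OF entire_mat_continuous_on[OF C, of UNIV]]) simp
      moreover have "continuous_on ({a..b} \<times> K) (\<lambda>p. V0 (fst p))" "continuous_on ({a..b} \<times> K) (\<lambda>p. M0 (fst p))"
        by (rule continuous_on_compose2[OF V0_cont] continuous_on_compose2[OF M0_cont]; auto intro!: continuous_intros)+
      ultimately show ?thesis
        unfolding F'_def case_prod_beta
        by (intro cmm.continuous_on continuous_on_add csc.continuous_on continuous_on_const continuous_on_snd continuous_on_id)
    qed
    show ?thesis
    proof (rule birkhoff_derivative(2)[where F = F and F' = "F' x0" and em = em and Q = Q and r = r])
      show "uniform_limit {l. r \<le> norm l \<and> norm l \<le> 2 * r} (\<lambda>x l. (F x l - F x0 l) /\<^sub>R (x - x0)) (F' x0)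
          (at x0 within {a..b})"
        using uniform_limit_difference_quotient[OF F_deriv cont _ x0] compact_annulus[of r]
        unfolding K_def by blast
      show "continuous_on {l. r \<le> norm l \<and> norm l \<le> 2 * r} (F' x0)"
      proof -
        have "continuous_on K (\<lambda>l. (x0, l))"
          by (intro continuous_on_Pair continuous_on_const continuous_on_id)
        moreover have "(\<lambda>l. (x0, l)) ` K \<subseteq> {a..b} \<times> K"
          using x0 by auto
        ultimately show ?thesis
          using continuous_on_compose2[OF cont, of K "\<lambda>l. (x0, l)"] by (simp add: K_def)
      qed
      fix l :: complex assume "l \<in> {l. r \<le> norm l \<and> norm l \<le> 2 * r}"
      then have l: "l \<noteq> 0"
        using K0 by (simp add: K_def)
      show "F x l ** Q x (1 / l) = P x l" if "x \<in> {a..b}" for x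
        using fac[OF that l] by (simp add: F_def)
      \<comment> \<open>The factorization replaces \<open>adj2 P ** F\<close> by
        \<open>adj2 Q\<close>, so the expression to be split is the potential conjugated by
        \<open>Q\<close>.\<close>
      have "F x0 l = P x0 l ** adj2 (Q x0 (1 / l))"
        unfolding fac[OF x0 l, symmetric] F_def
        by (simp add: mult_adj2[OF det(2)] flip: matrix_mul_assoc)
      then have "adj2 (P x0 l) ** F x0 l = adj2 (Q x0 (1 / l))"
        by (simp add: matrix_mul_assoc mult_adj2[OF det(1)])
      moreover have "F' x0 l = F x0 l ** (l *m M1 + M0 x0)"
        by (simp add: F_def F'_def matrix_mul_assoc)
      ultimately show "adj2 (P x0 l) ** F' x0 l ** Q x0 (1 / l) = ep l + em (1 / l)"
        using split[OF l] by (simp add: matrix_mul_assoc)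
    qed (use x0 r P Q Q0 det ent em0 in auto)
  qed
  then show thesis
    using that unfolding ep_def by blast
qed

text \<open>Differentiating \<open>F\<close> produces \<open>- N / l\<close> on the left, so the
  expression to be split is \<open>- adj2 P ** N ** P / l\<close>. As \<open>P\<close> is entire in
  \<open>l\<close>, the only negative power is \<open>1 / l\<close>, and its coefficient involves
  just the value of \<open>P\<close> at 0.\<close>

lemma y_derivative:
  fixes W P Q :: "real \<Rightarrow> complex \<Rightarrow> cmat" and B :: "complex \<Rightarrow> cmat"
  assumes y0: "y0 \<in> {c..d}"
    and W: "\<And>y z. y \<in> {c..d} \<Longrightarrow>
       ((\<lambda>y. W y z) has_vector_derivative z *m (W y z ** N y)) (at y within {c..d})"
    and W_cont: "\<And>r. continuous_on ({c..d} \<times> cball 0 r) (\<lambda>(y, z). W y z)"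
    and N: "continuous_on {c..d} N" "\<And>y. y \<in> {c..d} \<Longrightarrow> N y $ 1 $ 1 + N y $ 2 $ 2 = 0"
    and B: "entire_mat B"
    and P: "\<And>y. y \<in> {c..d} \<Longrightarrow> entire_mat (P y)" and Q: "\<And>y. y \<in> {c..d} \<Longrightarrow> entire_mat (Q y)"
    and Q0: "\<And>y. y \<in> {c..d} \<Longrightarrow> Q y 0 = mat 1"
    and det: "\<And>z. det (P y0 z) = 1" "\<And>z. det (Q y0 z) = 1"
    and fac: "\<And>y l. y \<in> {c..d} \<Longrightarrow> l \<noteq> 0 \<Longrightarrow> adj2 (W y (1 / l)) ** B l ** Q y (1 / l) = P y l"
  shows "((\<lambda>y. Q y z) has_vector_derivative
      Q y0 z ** (z *m (adj2 (P y0 0) ** N y0 ** P y0 0))) (at y0 within {c..d})"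
proof -
  define F where "F y l = adj2 (W y (1 / l)) ** B l" for y l
  define F' where "F' y l = - ((1 / l) *m (N y ** F y l))" for y l
  have F_deriv: "((\<lambda>y. F y l) has_vector_derivative F' y l) (at y within {c..d})" if "y \<in> {c..d}" for y l
  proof -
    have "((\<lambda>y. F y l) has_vector_derivative adj2 ((1 / l) *m (W y (1 / l) ** N y)) ** B l) (at y within {c..d})"
      unfolding F_def
      by (intro bounded_linear.has_vector_derivative[OF cmm.bounded_linear_left]
          bounded_linear.has_vector_derivative[OF bounded_linear_adj2] W that)
    moreover have "adj2 ((1 / l) *m (W y (1 / l) ** N y)) ** B l = F' y l"
      by (simp add: F'_def F_def adj2_cscale adj2_mult adj2_traceless[OF N(2)[OF that]]
          cmm.minus_left csc.minus_right cscale_mult_left matrix_mul_assoc)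
    ultimately show ?thesis
      by simp
  qed
  obtain P1 where P1: "entire_mat P1" "\<And>l. P y0 l = P y0 0 + l *m P1 l"
    using entire_mat_factor[OF P[OF y0]] by blast
  define R where "R = P y0 0"
  define em where "em z = - (z *m (adj2 R ** N y0 ** R))" for z
  define ep where "ep l = - (adj2 (P1 l) ** N y0 ** R + adj2 R ** N y0 ** P1 l +
    l *m (adj2 (P1 l) ** N y0 ** P1 l))" for l
  have split: "- ((1 / l) *m (adj2 (P y0 l) ** N y0 ** P y0 l)) = ep l + em (1 / l)" if "l \<noteq> 0" for l
  proof -
    define z where "z = 1 / l"
    have lz: "z * l = 1"
      using that by (simp add: z_def)
    have "adj2 (P y0 l) ** N y0 ** P y0 l = adj2 R ** N y0 ** R +
        l *m (adj2 (P1 l) ** N y0 ** R + adj2 R ** N y0 ** P1 l + l *m (adj2 (P1 l) ** N y0 ** P1 l))"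
      unfolding P1(2)[of l] R_def[symmetric]
      by (simp add: adj2_add adj2_cscale cmm.add_left cmm.add_right csc.add_right
          cscale_mult_left cscale_mult_right)
    then show ?thesis
      unfolding z_def[symmetric] by (simp add: csc.add_right cscale_cscale lz cscale_one ep_def em_def
          mult.assoc[symmetric])
  qed
  have ent: "entire_mat ep" "entire_mat em" and em0: "em 0 = 0"
  proof -
    show "entire_mat ep"
      unfolding ep_def by (intro entire_mat_intros P1 holomorphic_intros)
    show "entire_mat em"
      unfolding em_def by (intro entire_mat_intros holomorphic_intros)
    show "em 0 = 0"
      by (simp add: em_def csc.zero_left)
  qed
  \<comment> \<open>Now \<open>z\<close> has to lie in the disc of radius \<open>1 / r\<close>,
    where the derivative of \<open>Q\<close> is obtained.\<close>
  define r where "r = 1 / (norm z + 1)"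
  define K where "K = {l::complex. r \<le> norm l \<and> norm l \<le> 2 * r}"
  have r: "0 < r" "norm z \<le> 1 / r"
    by (auto simp: r_def add_nonneg_pos)
  have K0: "l \<noteq> 0" if "l \<in> K" for l
    using that r by (auto simp: K_def)
  have cont: "continuous_on ({c..d} \<times> K) (\<lambda>(y, l). F' y l)"
  proof -
    have inv: "continuous_on ({c..d} \<times> K) (\<lambda>p. 1 / snd p)"
      using K0 by (intro continuous_intros) auto
    have "continuous_on ({c..d} \<times> K) (\<lambda>p. W (fst p) (1 / snd p))"
      by (rule continuous_on_compose2[OF W_cont[of "1 / r", unfolded case_prod_beta], of _ "\<lambda>p. (fst p, 1 / snd p)", simplified])
        (use r in \<open>auto intro!: continuous_intros inv simp: K_def norm_divide frac_le\<close>)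
    moreover have "continuous_on ({c..d} \<times> K) (\<lambda>p. B (snd p))"
      by (rule continuous_on_compose2[OF entire_mat_continuous_on[OF B, of UNIV]]) (auto intro!: continuous_intros)
    moreover have "continuous_on ({c..d} \<times> K) (\<lambda>p. N (fst p))"
      by (rule continuous_on_compose2[OF N(1)]) (auto intro!: continuous_intros)
    ultimately show ?thesis
      unfolding F'_def F_def case_prod_beta
      by (intro continuous_on_minus csc.continuous_on inv cmm.continuous_on
          bounded_linear.continuous_on[OF bounded_linear_adj2])
  qed
  have "((\<lambda>y. Q y z) has_vector_derivative - (Q y0 z ** em z)) (at y0 within {c..d})"
  proof (rule birkhoff_derivative(1)[where F = F and F' = "F' y0" and ep = ep and P = P and r = r])
    show "uniform_limit {l. r \<le> norm l \<and> norm l \<le> 2 * r} (\<lambda>y l. (F y l - F y0 l) /\<^sub>R (y - y0)) (F' y0)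
        (at y0 within {c..d})"
      using uniform_limit_difference_quotient[OF F_deriv cont _ y0] compact_annulus[of r]
      unfolding K_def by blast
    show "continuous_on {l. r \<le> norm l \<and> norm l \<le> 2 * r} (F' y0)"
    proof -
      have "continuous_on K (\<lambda>l. (y0, l))"
        by (intro continuous_on_Pair continuous_on_const continuous_on_id)
      moreover have "(\<lambda>l. (y0, l)) ` K \<subseteq> {c..d} \<times> K"
        using y0 by auto
      ultimately show ?thesis
        using continuous_on_compose2[OF cont, of K "\<lambda>l. (y0, l)"] by (simp add: K_def)
    qed
    fix l :: complex assume "l \<in> {l. r \<le> norm l \<and> norm l \<le> 2 * r}"
    then have l: "l \<noteq> 0"
      using K0 by (simp add: K_def)
    show F: "F y l ** Q y (1 / l) = P y l" if "y \<in> {c..d}" for y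
      using fac[OF that l] by (simp add: F_def)
    have "adj2 (P y0 l) ** F' y0 l ** Q y0 (1 / l) =
        - ((1 / l) *m (adj2 (P y0 l) ** N y0 ** (F y0 l ** Q y0 (1 / l))))"
      by (simp add: F'_def cmm.minus_left cmm.minus_right cscale_mult_left cscale_mult_right matrix_mul_assoc)
    then show "adj2 (P y0 l) ** F' y0 l ** Q y0 (1 / l) = ep l + em (1 / l)"
      using split[OF l] by (simp add: F[OF y0])
  qed (use y0 r P Q Q0 det ent em0 in auto)
  then show ?thesis
    by (simp add: em_def R_def cmm.minus_right)
qed

lemma smooth_on_C1:
  assumes "smooth_on D f"
  obtains f' where "\<And>x. x \<in> D \<Longrightarrow> (f has_real_derivative f' x) (at x within D)" "continuous_on D f'"
    "continuous_on D f"
proof -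
  obtain d :: "nat \<Rightarrow> real \<Rightarrow> real" where d: "\<And>x. x \<in> D \<Longrightarrow> d 0 x = f x"
    "\<And>n x. x \<in> D \<Longrightarrow> (d n has_real_derivative d (Suc n) x) (at x within D)"
    using assms unfolding smooth_on_def by blast
  have f: "(f has_real_derivative d 1 x) (at x within D)" if "x \<in> D" for x
    using d(2)[OF that, of 0] has_vector_derivative_transform[OF that, of f "d 0" "d 1 x"] d(1)
    by (simp add: has_real_derivative_iff_has_vector_derivative)
  then have "continuous_on D f"
    by (rule DERIV_continuous_on)
  moreover have "continuous_on D (d 1)"
    using d(2) by (rule DERIV_continuous_on)
  ultimately show thesis
    using that f by blast
qed

definition fundamental_solution ::
  "(real \<Rightarrow> cmat) \<Rightarrow> real \<Rightarrow> real \<Rightarrow> (real \<Rightarrow> complex \<Rightarrow> cmat) \<Rightarrow> bool" where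
  "fundamental_solution A a b W \<longleftrightarrow>
    (\<forall>x\<in>{a..b}. \<forall>z.
       ((\<lambda>x. W x z) has_vector_derivative z *m (W x z ** A x)) (at x within {a..b})) \<and>
    (\<forall>r. continuous_on ({a..b} \<times> cball 0 r) (\<lambda>(x, z). W x z)) \<and>
    (\<forall>x\<in>{a..b}. W x 0 = mat 1) \<and> (\<forall>x\<in>{a..b}. entire_mat (W x)) \<and>
    (\<forall>x\<in>{a..b}. \<forall>z. det (W x z) = 1)"

lemma fundamental_solutionD:
  assumes "fundamental_solution A a b W"
  shows "\<And>x z. x \<in> {a..b} \<Longrightarrow>
       ((\<lambda>x. W x z) has_vector_derivative z *m (W x z ** A x)) (at x within {a..b})"
    "\<And>r. continuous_on ({a..b} \<times> cball 0 r) (\<lambda>(x, z). W x z)"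
    "\<And>x. x \<in> {a..b} \<Longrightarrow> W x 0 = mat 1"
    "\<And>x. x \<in> {a..b} \<Longrightarrow> entire_mat (W x)"
    "\<And>x z. x \<in> {a..b} \<Longrightarrow> det (W x z) = 1"
  using assms unfolding fundamental_solution_def by blast+

text \<open>The parameter \<open>\<kappa> l\<close> is \<open>l\<close> for \<open>UX\<close> and
  \<open>1 / l\<close> for \<open>UY\<close>. Uniqueness identifies the given solution, known for
  real \<open>l\<close>, with one that is entire in its parameter.\<close>

lemma local_fundamental_solution:
  fixes X :: "real \<Rightarrow> real \<Rightarrow> cmat" and \<kappa> :: "real \<Rightarrow> complex"
  assumes "is_interval D" "0 \<in> D" "x0 \<in> D" "continuous_on D A"
    and "\<And>x. x \<in> D \<Longrightarrow> A x $ 1 $ 1 + A x $ 2 $ 2 = 0"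
    and "\<And>x l. x \<in> D \<Longrightarrow> l \<noteq> 0 \<Longrightarrow> has_left_log_derivative (\<lambda>s. X s l) (\<kappa> l *m A x) x D"
    and "\<And>l. l \<noteq> 0 \<Longrightarrow> X 0 l = mat 1"
  obtains a b W where "{a..b} \<subseteq> D" "x0 \<in> {a..b}" "at x0 within D = at x0 within {a..b}"
    "fundamental_solution A a b W" "\<And>x l. x \<in> {a..b} \<Longrightarrow> l \<noteq> 0 \<Longrightarrow> X x l = W x (\<kappa> l)"
proof -
  obtain a b where ab: "{a..b} \<subseteq> D" "0 \<in> {a..b}" "x0 \<in> {a..b}" "at x0 within D = at x0 within {a..b}"
    using compact_subinterval[OF assms(1-3)] by blast
  show thesis
  proof (rule ode_fundamental[OF _ _ ab(2)])
    show "continuous_on {a..b} A"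
      using continuous_on_subset[OF assms(4) ab(1)] .
    show "A x $ 1 $ 1 + A x $ 2 $ 2 = 0" if "x \<in> {a..b}" for x
      using assms(5) ab(1) that by blast
    fix W
    assume W: "\<And>z. W 0 z = mat 1"
      "\<And>x z. x \<in> {a..b} \<Longrightarrow>
         ((\<lambda>x. W x z) has_vector_derivative z *m (W x z ** A x)) (at x within {a..b})"
      "\<And>x. x \<in> {a..b} \<Longrightarrow> entire_mat (W x)"
      "\<And>r. continuous_on ({a..b} \<times> cball 0 r) (\<lambda>(x, z). W x z)"
      "\<And>x z. x \<in> {a..b} \<Longrightarrow> det (W x z) = 1"
      "\<And>x. x \<in> {a..b} \<Longrightarrow> W x 0 = mat 1"
      "\<And>U z x. U 0 = mat 1 \<Longrightarrow> (\<And>x. x \<in> {a..b} \<Longrightarrow>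
         (U has_vector_derivative z *m (U x ** A x)) (at x within {a..b})) \<Longrightarrow>
         x \<in> {a..b} \<Longrightarrow> U x = W x z"
    have X: "X x l = W x (\<kappa> l)" if "x \<in> {a..b}" "l \<noteq> 0" for x l
    proof (rule W(7)[of "\<lambda>x. X x l", OF _ _ that(1)])
      show "X 0 l = mat 1"
        using assms(7) that(2) .
      fix x assume "x \<in> {a..b}"
      with ab(1) have "x \<in> D"
        by blast
      from has_left_log_derivative_mult[OF assms(6)[OF this that(2)]]
      show "((\<lambda>x. X x l) has_vector_derivative \<kappa> l *m (X x l ** A x)) (at x within {a..b})"
        unfolding cscale_mult_right by (rule has_vector_derivative_within_subset[OF _ ab(1)])
    qed
    have "fundamental_solution A a b W"
      unfolding fundamental_solution_def using W(2-6) by blast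
    then show thesis
      using that[OF ab(1,3,4) _ X] by blast
  qed
qed

text \<open>An interval is contractible, so the nowhere vanishing \<open>f\<close> has a continuous
  logarithm, purely imaginary because \<open>norm (f x) = 1\<close>. Subtracting its value at
  \<open>u\<close> normalizes the lift.\<close>

lemma unit_circle_lift:
  fixes f :: "real \<Rightarrow> complex" and p :: "real \<Rightarrow> real"
  assumes "is_interval D" "u \<in> D" "f u = 1"
    and norm: "\<And>x. x \<in> D \<Longrightarrow> norm (f x) = 1"
    and deriv: "\<And>x. x \<in> D \<Longrightarrow> (f has_vector_derivative - (\<i> / 2 * of_real (p x) * f x)) (at x within D)"
  obtains \<psi> where "\<psi> u = 0" "\<And>x. x \<in> D \<Longrightarrow> f x = exp (- \<i> * of_real (\<psi> x) / 2)"
    "\<And>x. x \<in> D \<Longrightarrow> (\<psi> has_real_derivative p x) (at x within D)"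
proof -
  have "continuous_on D f"
    using deriv has_vector_derivative_continuous continuous_on_eq_continuous_within by blast
  moreover have "contractible D"
    using assms(1) by (simp add: is_interval_convex convex_imp_contractible)
  moreover have "f x \<noteq> 0" if "x \<in> D" for x
    using norm[OF that] by auto
  ultimately obtain g where g: "continuous_on D g" "\<And>x. x \<in> D \<Longrightarrow> f x = exp (g x)"
    using continuous_logarithm_on_contractible by metis
  define \<psi> where "\<psi> x = 2 * Im (g u) - 2 * Im (g x)" for x
  have gI: "g x = \<i> * of_real (Im (g x))" if "x \<in> D" for x
    using norm[OF that] g(2)[OF that] by (simp add: complex_eq_iff)
  have f: "f x = exp (- \<i> * of_real (\<psi> x) / 2)" if "x \<in> D" for x
  proof -
    have "f x = exp (g x) / exp (g u)"
      using g(2) that assms(2,3) by simp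
    also have "\<dots> = exp (g x - g u)"
      by (simp add: exp_diff)
    also have "g x - g u = - \<i> * of_real (\<psi> x) / 2"
      by (subst gI[OF that], subst gI[OF assms(2)]) (simp add: \<psi>_def algebra_simps)
    finally show ?thesis .
  qed
  have "continuous_on D \<psi>"
    unfolding \<psi>_def by (intro continuous_intros g)
  then have "(\<psi> has_real_derivative p x) (at x within D)" if "x \<in> D" for x
    using that f deriv[OF that]
    by (intro has_real_derivative_of_exp[of x D \<psi> f]) (auto simp: continuous_on_eq_continuous_within)
  with f show thesis
    by (intro that[of \<psi>]) (auto simp: \<psi>_def)
qed

theorem theorem2p7:
  fixes D1 D2 :: "real set"
    and \<alpha> \<beta> :: "real \<Rightarrow> real"
    and V0 :: "real \<Rightarrow> complex^2^2"
    and UX UY :: "real \<Rightarrow> real \<Rightarrow> complex^2^2"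
    and V T U :: "real \<Rightarrow> real \<Rightarrow> real \<Rightarrow> complex^2^2"
  assumes "is_interval D1" "0 \<in> D1" "is_interval D2" "0 \<in> D2"
    and "smooth_on D1 \<alpha>" "smooth_on D2 \<beta>" "\<alpha> 0 = 0"
    and "V0 = (\<lambda>x. mat2 (exp (- \<i> * of_real (\<alpha> x) / 2)) 0 0 (exp (\<i> * of_real (\<alpha> x) / 2)))"
    and "\<And>x l. x \<in> D1 \<Longrightarrow> l \<noteq> 0 \<Longrightarrow>
           has_left_log_derivative (\<lambda>s. UX s l)
             ((\<i> / 2 * of_real l) *m
               mat2 0 (exp (- \<i> * of_real (\<alpha> x))) (exp (\<i> * of_real (\<alpha> x))) 0) x D1"
    and "\<And>y l. y \<in> D2 \<Longrightarrow> l \<noteq> 0 \<Longrightarrow>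
           has_left_log_derivative (\<lambda>t. UY t l)
             ((- \<i> / (2 * of_real l)) *m
               mat2 0 (exp (\<i> * of_real (\<beta> y))) (exp (- \<i> * of_real (\<beta> y))) 0) y D2"
    and "\<And>l. l \<noteq> 0 \<Longrightarrow> UX 0 l = mat 1"
    and "\<And>l. l \<noteq> 0 \<Longrightarrow> UY 0 l = mat 1"
    and "\<And>x y. x \<in> D1 \<Longrightarrow> y \<in> D2 \<Longrightarrow> V x y \<in> Loop_plus"
    and "\<And>x y. x \<in> D1 \<Longrightarrow> y \<in> D2 \<Longrightarrow> T x y \<in> Loop_minus_star"
    and "\<And>x y l. x \<in> D1 \<Longrightarrow> y \<in> D2 \<Longrightarrow> l \<noteq> 0 \<Longrightarrow>
           matrix_inv (UY y l) ** UX x l ** V0 x = V x y l ** matrix_inv (T x y l)"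
    and "U = (\<lambda>x y l. UX x l ** V0 x ** T x y l)"
  shows "(\<forall>x\<in>D1. \<forall>y\<in>D2. \<forall>l. l \<noteq> 0 \<longrightarrow> U x y l = UY y l ** V x y l) \<and>
    (\<forall>l. l \<noteq> 0 \<longrightarrow> U 0 0 l = mat 1) \<and>
    (\<exists>\<phi> \<phi>x :: real \<Rightarrow> real \<Rightarrow> real.
       (\<forall>x\<in>D1. \<phi> x 0 = \<alpha> x + \<beta> 0) \<and>
       (\<forall>y\<in>D2. \<phi> 0 y = \<beta> y) \<and>
       (\<forall>x\<in>D1. \<forall>y\<in>D2.
          ((\<lambda>s. \<phi> s y) has_real_derivative \<phi>x x y) (at x within D1) \<and>
          (\<forall>l. l \<noteq> 0 \<longrightarrow>
             ((\<lambda>s. U s y l) has_vector_derivative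
                (\<i> / 2) *m (U x y l ** mat2 (- of_real (\<phi>x x y)) (of_real l)
                                           (of_real l) (of_real (\<phi>x x y))))
               (at x within D1) \<and>
             ((\<lambda>t. U x t l) has_vector_derivative
                (- \<i> / (2 * of_real l)) *m
                  (U x y l ** mat2 0 (exp (\<i> * of_real (\<phi> x y)))
                                   (exp (- \<i> * of_real (\<phi> x y))) 0))
               (at y within D2))))"
proof -

  \<comment> \<open>Potentials and local solutions with complex spectral parameter\<close>
  note V0 = assms(8)
  obtain \<alpha>' where \<alpha>': "\<And>x. x \<in> D1 \<Longrightarrow> (\<alpha> has_real_derivative \<alpha>' x) (at x within D1)"
    "continuous_on D1 \<alpha>'" "continuous_on D1 \<alpha>"
    using smooth_on_C1[OF assms(5)] by blast
  have \<beta>: "continuous_on D2 \<beta>"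
    using smooth_on_C1[OF assms(6)] by blast
  \<comment> \<open>The numerical factors are absorbed into \<open>A\<close> and \<open>N\<close>,
    so that the potentials become \<open>l *m A x\<close> and \<open>(1 / l) *m N y\<close>.\<close>
  define A where "A x = mat2 0 (\<i> / 2 * exp (- \<i> * of_real (\<alpha> x))) (\<i> / 2 * exp (\<i> * of_real (\<alpha> x))) 0" for x
  define N where "N y = mat2 0 (- \<i> / 2 * exp (\<i> * of_real (\<beta> y))) (- \<i> / 2 * exp (- \<i> * of_real (\<beta> y))) 0" for y
  have mat2_cont: "continuous_on S (\<lambda>x. mat2 0 (f x) (g x) 0)"
    if "continuous_on S f" "continuous_on S g" for f g and S :: "real set"
  proof -
    have lin: "bounded_linear (\<lambda>c. mat2 0 c 0 0)" "bounded_linear (\<lambda>c. mat2 0 0 c 0)"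
      by (intro linear_conv_bounded_linear[THEN iffD1] linearI; simp add: cmat_eq_iff)+
    have "(\<lambda>x. mat2 0 (f x) (g x) 0) = (\<lambda>x. mat2 0 (f x) 0 0 + mat2 0 0 (g x) 0)"
      by (simp add: fun_eq_iff cmat_eq_iff)
    moreover have "continuous_on S (\<lambda>x. mat2 0 (f x) 0 0 + mat2 0 0 (g x) 0)"
      by (intro continuous_on_add bounded_linear.continuous_on[OF lin(1)]
          bounded_linear.continuous_on[OF lin(2)] that)
    ultimately show ?thesis
      by (simp only:)
  qed
  have A: "continuous_on D1 A" "A x $ 1 $ 1 + A x $ 2 $ 2 = 0" for x
    unfolding A_def by (intro mat2_cont continuous_intros \<alpha>') simp_all
  have N: "continuous_on D2 N" "N y $ 1 $ 1 + N y $ 2 $ 2 = 0" for y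
    unfolding N_def by (intro mat2_cont continuous_intros \<beta>) simp_all
  have UX: "has_left_log_derivative (\<lambda>s. UX s l) (of_real l *m A x) x D1" if "x \<in> D1" "l \<noteq> 0" for x l
  proof -
    have "of_real l *m A x = (\<i> / 2 * of_real l) *m
        mat2 0 (exp (- \<i> * of_real (\<alpha> x))) (exp (\<i> * of_real (\<alpha> x))) 0"
      by (simp add: A_def cmat_eq_iff)
    then show ?thesis
      using assms(9)[OF that] by simp
  qed
  have UY: "has_left_log_derivative (\<lambda>t. UY t l) ((1 / of_real l) *m N y) y D2" if "y \<in> D2" "l \<noteq> 0" for y l
  proof -
    have "(1 / of_real l) *m N y = (- \<i> / (2 * of_real l)) *m
        mat2 0 (exp (\<i> * of_real (\<beta> y))) (exp (- \<i> * of_real (\<beta> y))) 0"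
      by (simp add: N_def cmat_eq_iff)
    then show ?thesis
      using assms(10)[OF that] by simp
  qed
  have X_local: "\<exists>a b W. {a..b} \<subseteq> D1 \<and> x \<in> {a..b} \<and> at x within D1 = at x within {a..b} \<and>
      fundamental_solution A a b W \<and> (\<forall>x\<in>{a..b}. \<forall>l. l \<noteq> 0 \<longrightarrow> UX x l = W x (of_real l))"
    if "x \<in> D1" for x
    by (rule local_fundamental_solution[of D1 x A UX of_real]) (use assms(1,2,11) that A UX in blast)+
  have Y_local: "\<exists>c d W. {c..d} \<subseteq> D2 \<and> y \<in> {c..d} \<and> at y within D2 = at y within {c..d} \<and>
      fundamental_solution N c d W \<and> (\<forall>y\<in>{c..d}. \<forall>l. l \<noteq> 0 \<longrightarrow> UY y l = W y (1 / of_real l))"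
    if "y \<in> D2" for y
    by (rule local_fundamental_solution[of D2 y N UY "\<lambda>l. 1 / of_real l"]) (use assms(3,4,12) that N UY in blast)+

  \<comment> \<open>Entire representatives of the two Birkhoff factors\<close>
  define isP where "isP x y P \<longleftrightarrow> entire_mat P \<and> (\<forall>l. l \<noteq> 0 \<longrightarrow> V x y l = P (of_real l)) \<and> (\<forall>z. det (P z) = 1) \<and>
      P 0 $ 1 $ 2 = 0 \<and> P 0 $ 2 $ 1 = 0 \<and> P 0 $ 2 $ 2 = cnj (P 0 $ 1 $ 1)" for x y P
  have "\<exists>P. isP x y P" if "x \<in> D1" "y \<in> D2" for x y
    unfolding isP_def using Loop_plus_entire[OF assms(13)[OF that]] by metis
  then obtain P where isP: "\<And>x y. x \<in> D1 \<Longrightarrow> y \<in> D2 \<Longrightarrow> isP x y (P x y)"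
    by metis
  have P: "\<And>x y. x \<in> D1 \<Longrightarrow> y \<in> D2 \<Longrightarrow> entire_mat (P x y)"
    "\<And>x y l. x \<in> D1 \<Longrightarrow> y \<in> D2 \<Longrightarrow> l \<noteq> 0 \<Longrightarrow> V x y l = P x y (of_real l)"
    "\<And>x y z. x \<in> D1 \<Longrightarrow> y \<in> D2 \<Longrightarrow> det (P x y z) = 1"
    "\<And>x y. x \<in> D1 \<Longrightarrow> y \<in> D2 \<Longrightarrow> P x y 0 $ 1 $ 2 = 0"
    "\<And>x y. x \<in> D1 \<Longrightarrow> y \<in> D2 \<Longrightarrow> P x y 0 $ 2 $ 1 = 0"
    "\<And>x y. x \<in> D1 \<Longrightarrow> y \<in> D2 \<Longrightarrow> P x y 0 $ 2 $ 2 = cnj (P x y 0 $ 1 $ 1)"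
    using isP unfolding isP_def by blast+
  define isQ where "isQ x y Q \<longleftrightarrow> entire_mat Q \<and> (\<forall>l. l \<noteq> 0 \<longrightarrow> T x y l = Q (1 / of_real l)) \<and> (\<forall>z. det (Q z) = 1) \<and>
      Q 0 = mat 1 \<and> (\<forall>l::real. l \<noteq> 0 \<longrightarrow> Q (of_real l) \<in> SU2) \<and>
      (\<forall>l::real. l \<noteq> 0 \<longrightarrow> Q (- of_real l) $ 1 $ 1 = Q (of_real l) $ 1 $ 1)" for x y Q
  have "\<exists>Q. isQ x y Q" if "x \<in> D1" "y \<in> D2" for x y
    unfolding isQ_def using Loop_minus_star_entire[OF assms(14)[OF that]] by metis
  then obtain Q where isQ: "\<And>x y. x \<in> D1 \<Longrightarrow> y \<in> D2 \<Longrightarrow> isQ x y (Q x y)"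
    by metis
  have Q: "\<And>x y. x \<in> D1 \<Longrightarrow> y \<in> D2 \<Longrightarrow> entire_mat (Q x y)"
    "\<And>x y l. x \<in> D1 \<Longrightarrow> y \<in> D2 \<Longrightarrow> l \<noteq> 0 \<Longrightarrow> T x y l = Q x y (1 / of_real l)"
    "\<And>x y z. x \<in> D1 \<Longrightarrow> y \<in> D2 \<Longrightarrow> det (Q x y z) = 1"
    "\<And>x y. x \<in> D1 \<Longrightarrow> y \<in> D2 \<Longrightarrow> Q x y 0 = mat 1"
    "\<And>x y l. x \<in> D1 \<Longrightarrow> y \<in> D2 \<Longrightarrow> l \<noteq> 0 \<Longrightarrow> Q x y (of_real l) \<in> SU2"
    "\<And>x y l. x \<in> D1 \<Longrightarrow> y \<in> D2 \<Longrightarrow> l \<noteq> 0 \<Longrightarrow>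
      Q x y (- of_real l) $ 1 $ 1 = Q x y (of_real l) $ 1 $ 1"
    using isQ unfolding isQ_def by blast+

  \<comment> \<open>The factorization for complex spectral parameter\<close>
  have UY_det: "det (UY y l) = 1" if "y \<in> D2" "l \<noteq> 0" for y l
    using Y_local[OF that(1)] that(2) fundamental_solutionD(5) by metis
  have real_fac: "adj2 (UY y l) ** (UX x l ** V0 x) ** T x y l = V x y l"
    if "x \<in> D1" "y \<in> D2" "l \<noteq> 0" for x y l
  proof -
    have "adj2 (UY y l) ** (UX x l ** V0 x) = V x y l ** adj2 (T x y l)"
      using assms(15)[OF that] UY_det[OF that(2,3)] Q(2,3)[OF that(1,2)] that(3)
      by (simp add: matrix_inv_eq_adj2 matrix_mul_assoc)
    then show ?thesis
      using Q(2,3)[OF that(1,2)] that(3) by (simp add: mult_adj2 flip: matrix_mul_assoc)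
  qed
  have fac: "adj2 (WY (1 / l)) ** (WX l ** V0 x) ** Q x y (1 / l) = P x y l"
    if "x \<in> D1" "y \<in> D2" "l \<noteq> 0" "entire_mat WX" "entire_mat WY"
      "\<And>l. l \<noteq> 0 \<Longrightarrow> UX x l = WX (of_real l)" "\<And>l. l \<noteq> 0 \<Longrightarrow> UY y l = WY (1 / of_real l)"
    for x y l WX WY
  proof (rule laurent_eq_from_reals[where A = "\<lambda>z. adj2 (WY z)" and B = "\<lambda>l. WX l ** V0 x"])
    fix l :: real assume "l \<noteq> 0"
    then show "adj2 (WY (1 / of_real l)) ** (WX (of_real l) ** V0 x) ** Q x y (1 / of_real l) = P x y (of_real l)"
      using real_fac[OF that(1,2)] that(6,7) P(2)[OF that(1,2)] Q(2)[OF that(1,2)] by simp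
  qed (rule entire_mat_adj2[OF that(5)] entire_mat_mult[OF that(4) entire_mat_const]
      Q(1)[OF that(1,2)] P(1)[OF that(1,2)] that(3))+

  have U_eq: "U x y l = UY y l ** V x y l" if "x \<in> D1" "y \<in> D2" "l \<noteq> 0" for x y l
    unfolding real_fac[OF that, symmetric] assms(16) using mult_adj2(1)[OF UY_det[OF that(2,3)]]
    by (simp add: matrix_mul_assoc)

  \<comment> \<open>Values of the factors on the coordinate axes\<close>
  have V0_0: "V0 0 = mat 1"
    by (simp add: V0 assms(7) cmat_eq_iff)
  \<comment> \<open>For \<open>y = 0\<close> the matrix \<open>UY\<close> is the identity. The
    factorization then equates an entire function of \<open>l\<close> with the minus factor, which
    is entire in \<open>1 / l\<close>, so both are constant.\<close>
  have Q_x0: "Q x 0 z = mat 1" and P_x0: "P x 0 0 = V0 x" if x: "x \<in> D1" for x z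
  proof -
    obtain a b W where W: "x \<in> {a..b}" "fundamental_solution A a b W"
      "\<And>x l. x \<in> {a..b} \<Longrightarrow> l \<noteq> 0 \<Longrightarrow> UX x l = W x (of_real l)"
      using X_local[OF x] by blast
    note W' = fundamental_solutionD[OF W(2)]
    have "W x l ** V0 x ** Q x 0 (1 / l) = P x 0 l" if "l \<noteq> 0" for l
      using fac[OF x assms(4) that W'(4)[OF W(1)] entire_mat_const[of "mat 1"] W(3)[OF W(1)] assms(12)]
      by simp
    moreover have det: "det (W x l ** V0 x) = 1" for l
      by (simp add: det_mul W'(5)[OF W(1)]) (simp add: V0 det_2 flip: exp_add)
    ultimately have eq: "adj2 (W x l ** V0 x) ** P x 0 l = Q x 0 (1 / l)" if "l \<noteq> 0" for l
      using that mult_adj2(2)[OF det] by (simp add: matrix_mul_assoc)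
        (metis matrix_mul_assoc matrix_mul_lid)
    have ent: "entire_mat (\<lambda>l. adj2 (W x l ** V0 x) ** P x 0 l)"
      by (intro entire_mat_intros W'(4)[OF W(1)] P x assms(4))
    note * = annulus_split_eq[OF ent Q(1)[OF x assms(4)] Q(4)[OF x assms(4)] eq]
    show "Q x 0 z = mat 1"
      by (rule *(1))
    have "(W x 0 ** V0 x) ** (adj2 (W x 0 ** V0 x) ** P x 0 0) = W x 0 ** V0 x"
      using *(2)[of 0] by simp
    then show "P x 0 0 = V0 x"
      unfolding matrix_mul_assoc[of _ "adj2 _"] mult_adj2(1)[OF det]
      by (simp add: W'(3)[OF W(1)])
  qed
  \<comment> \<open>For \<open>x = 0\<close> the roles are exchanged: \<open>UX\<close> and
    \<open>V0\<close> are the identity, and the plus factor equals a product that is entire in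
    \<open>1 / l\<close>.\<close>
  have P_0y: "P 0 y l = mat 1" if y: "y \<in> D2" for y l
  proof -
    obtain c d W where W: "y \<in> {c..d}" "fundamental_solution N c d W"
      "\<And>y l. y \<in> {c..d} \<Longrightarrow> l \<noteq> 0 \<Longrightarrow> UY y l = W y (1 / of_real l)"
      using Y_local[OF y] by blast
    note W' = fundamental_solutionD[OF W(2)]
    have eq: "P 0 y l = adj2 (W y (1 / l)) ** Q 0 y (1 / l)" if "l \<noteq> 0" for l
      using fac[OF assms(2) y that entire_mat_const[of "mat 1"] W'(4)[OF W(1)] assms(11) W(3)[OF W(1)]]
      by (simp add: V0_0)
    show ?thesis
    proof (rule annulus_split_eq(2)[where q = "\<lambda>z. adj2 (W y z) ** Q 0 y z", OF _ _ _ eq])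
      show "entire_mat (P 0 y)" "entire_mat (\<lambda>z. adj2 (W y z) ** Q 0 y z)"
        by (intro entire_mat_intros W'(4)[OF W(1)] P Q assms(2) y)+
      show "adj2 (W y 0) ** Q 0 y 0 = mat 1"
        by (simp add: W'(3)[OF W(1)] Q(4)[OF assms(2) y])
    qed
  qed
  have U00: "U 0 0 l = mat 1" if "l \<noteq> 0" for l
    using that assms(2,4) Q(2)[OF assms(2,4) that] by (simp add: assms(16) assms(11) V0_0 Q_x0)

  \<comment> \<open>Derivatives of the plus factor in \<open>x\<close> and of the minus factor in
    \<open>y\<close>\<close>
  have "\<exists>p::real. \<forall>l. ((\<lambda>x. P x y l) has_vector_derivative
      P x0 y l ** ((\<i> / 2) *m mat2 (- of_real p) l l (of_real p))) (at x0 within D1)"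
    if x0: "x0 \<in> D1" and y: "y \<in> D2" for x0 y
  proof -
    obtain a b W where W: "{a..b} \<subseteq> D1" "x0 \<in> {a..b}" "at x0 within D1 = at x0 within {a..b}"
      "fundamental_solution A a b W" "\<And>x l. x \<in> {a..b} \<Longrightarrow> l \<noteq> 0 \<Longrightarrow> UX x l = W x (of_real l)"
      using X_local[OF x0] by blast
    note WX = fundamental_solutionD[OF W(4)]
    obtain c d W' where W': "y \<in> {c..d}" "fundamental_solution N c d W'"
      "\<And>y l. y \<in> {c..d} \<Longrightarrow> l \<noteq> 0 \<Longrightarrow> UY y l = W' y (1 / of_real l)"
      using Y_local[OF y] by blast
    note WY = fundamental_solutionD(4)[OF W'(2,1)]
    have sub: "x \<in> D1" if "x \<in> {a..b}" for x
      using W(1) that by blast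
    have \<alpha>'_ab: "(\<alpha> has_real_derivative \<alpha>' x) (at x within {a..b})" if "x \<in> {a..b}" for x
      using has_field_derivative_subset[OF \<alpha>'(1)[OF sub[OF that]] W(1)] .
    have fac': "adj2 (W' y (1 / l)) ** (W x l ** V0 x) ** Q x y (1 / l) = P x y l"
      if "x \<in> {a..b}" "l \<noteq> 0" for x l
      using fac[OF sub[OF that(1)] y that(2) WX(4)[OF that(1)] WY W(5)[OF that(1)] W'(3)[OF W'(1)]] .
    obtain p :: real where "\<And>l. ((\<lambda>x. P x y l) has_vector_derivative
      P x0 y l ** ((\<i> / 2) *m mat2 (- of_real p) l l (of_real p))) (at x0 within {a..b})"
      using x_derivative[where P = "\<lambda>x. P x y" and Q = "\<lambda>x. Q x y" and C = "\<lambda>z. adj2 (W' y z)",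
          OF W(2) WX(1)[unfolded A_def] WX(2) \<alpha>'_ab continuous_on_subset[OF \<alpha>'(2) W(1)] V0
            entire_mat_adj2[OF WY] P(1)[OF sub y] Q(1)[OF sub y] Q(4)[OF sub y]
            P(3)[OF x0 y] Q(3)[OF x0 y] Q(5)[OF x0 y] Q(6)[OF x0 y] fac'] by blast
    then show ?thesis
      unfolding W(3) by blast
  qed
  then obtain px where px: "\<And>x0 y l. x0 \<in> D1 \<Longrightarrow> y \<in> D2 \<Longrightarrow>
      ((\<lambda>x. P x y l) has_vector_derivative
      P x0 y l ** ((\<i> / 2) *m mat2 (- of_real (px x0 y)) l l (of_real (px x0 y)))) (at x0 within D1)"
    by metis

  have Qy: "((\<lambda>y. Q x y z) has_vector_derivative
      Q x y0 z ** (z *m (adj2 (P x y0 0) ** N y0 ** P x y0 0))) (at y0 within D2)"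
    if x: "x \<in> D1" and y0: "y0 \<in> D2" for x y0 z
  proof -
    obtain c d W where W: "{c..d} \<subseteq> D2" "y0 \<in> {c..d}" "at y0 within D2 = at y0 within {c..d}"
      "fundamental_solution N c d W" "\<And>y l. y \<in> {c..d} \<Longrightarrow> l \<noteq> 0 \<Longrightarrow> UY y l = W y (1 / of_real l)"
      using Y_local[OF y0] by blast
    note WY = fundamental_solutionD[OF W(4)]
    obtain a b W' where W': "x \<in> {a..b}" "fundamental_solution A a b W'"
      "\<And>x l. x \<in> {a..b} \<Longrightarrow> l \<noteq> 0 \<Longrightarrow> UX x l = W' x (of_real l)"
      using X_local[OF x] by blast
    note WX = fundamental_solutionD(4)[OF W'(2,1)]
    have sub: "y \<in> D2" if "y \<in> {c..d}" for y
      using W(1) that by blast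
    have fac': "adj2 (W y (1 / l)) ** (W' x l ** V0 x) ** Q x y (1 / l) = P x y l"
      if "y \<in> {c..d}" "l \<noteq> 0" for y l
      using fac[OF x sub[OF that(1)] that(2) WX WY(4)[OF that(1)] W'(3)[OF W'(1)] W(5)[OF that(1)]] .
    show ?thesis
      unfolding W(3)
      by (rule y_derivative[where P = "P x" and Q = "Q x" and B = "\<lambda>l. W' x l ** V0 x",
          OF W(2) WY(1,2) continuous_on_subset[OF N(1) W(1)] N(2)
            entire_mat_mult[OF WX entire_mat_const] P(1)[OF x sub] Q(1)[OF x sub] Q(4)[OF x sub]
            P(3)[OF x y0] Q(3)[OF x y0] fac'])
  qed

  \<comment> \<open>Lifting the phase of \<open>P x y 0\<close> along \<open>x\<close>\<close>
  have "\<exists>\<psi>. (\<forall>x\<in>D1. P x y 0 $ 1 $ 1 = exp (- \<i> * of_real (\<psi> x) / 2)) \<and>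
      (\<forall>x\<in>D1. (\<psi> has_real_derivative px x y) (at x within D1)) \<and> \<psi> 0 = 0 \<and>
      (y = 0 \<longrightarrow> \<psi> = \<alpha>)" if y: "y \<in> D2" for y
  proof -
    have deriv: "((\<lambda>x. P x y 0 $ 1 $ 1) has_vector_derivative
        - (\<i> / 2 * of_real (px x y) * P x y 0 $ 1 $ 1)) (at x within D1)" if "x \<in> D1" for x
    proof -
      have "bounded_linear (\<lambda>A::cmat. A $ 1 $ 1)"
        by (intro linear_conv_bounded_linear[THEN iffD1] linearI) simp_all
      from bounded_linear.has_vector_derivative[OF this px[OF that y, of 0]]
      show ?thesis
        by (simp add: mult_ac)
    qed
    show ?thesis
    \<comment> \<open>For \<open>y = 0\<close> the given \<alpha> is itself a lift and is chosen,
      which yields \<phi> on the \<open>x\<close> axis without comparing two lifts.\<close>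
    proof (cases "y = 0")
      case True
      have "(\<alpha> has_real_derivative px x y) (at x within D1)" if "x \<in> D1" for x
        using that \<alpha>'(3) deriv[OF that] P_x0 True
        by (intro has_real_derivative_of_exp[of x D1 \<alpha> "\<lambda>x. P x y 0 $ 1 $ 1"])
          (auto simp: continuous_on_eq_continuous_within V0)
      then show ?thesis
        using True P_x0 assms(7) by (intro exI[of _ \<alpha>]) (auto simp: V0)
    next
      case False
      \<comment> \<open>\<open>P x y 0\<close> is diagonal with conjugate entries and determinant
        1.\<close>
      have "norm (P x y 0 $ 1 $ 1) = 1" if "x \<in> D1" for x
      proof -
        have "P x y 0 $ 1 $ 1 * cnj (P x y 0 $ 1 $ 1) = 1"
          using P(3)[OF that y, of 0] P(4-6)[OF that y] by (simp add: det_2)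
        then show ?thesis
          by (metis complex_mod_sqrt_Re_mult_cnj one_complex.simps(1) real_sqrt_one)
      qed
      then obtain \<psi> where "\<psi> 0 = 0" "\<And>x. x \<in> D1 \<Longrightarrow> P x y 0 $ 1 $ 1 = exp (- \<i> * of_real (\<psi> x) / 2)"
        "\<And>x. x \<in> D1 \<Longrightarrow> (\<psi> has_real_derivative px x y) (at x within D1)"
        using unit_circle_lift[OF assms(1,2), of "\<lambda>x. P x y 0 $ 1 $ 1" "\<lambda>x. px x y"] deriv P_0y[OF y]
        by auto
      then show ?thesis
        using False by blast
    qed
  qed
  then obtain \<psi> where \<psi>: "\<And>x y. x \<in> D1 \<Longrightarrow> y \<in> D2 \<Longrightarrow> P x y 0 $ 1 $ 1 = exp (- \<i> * of_real (\<psi> y x) / 2)"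
    "\<And>x y. x \<in> D1 \<Longrightarrow> y \<in> D2 \<Longrightarrow> (\<psi> y has_real_derivative px x y) (at x within D1)"
    "\<And>y. y \<in> D2 \<Longrightarrow> \<psi> y 0 = 0" "\<psi> 0 = \<alpha>"
    using assms(4) by metis

  \<comment> \<open>The function \<phi> and the equations for \<open>U\<close>\<close>
  define \<phi> where "\<phi> x y = \<psi> y x + \<beta> y" for x y
  have Ux: "((\<lambda>s. U s y l) has_vector_derivative
      (\<i> / 2) *m (U x y l ** mat2 (- of_real (px x y)) (of_real l) (of_real l) (of_real (px x y))))
      (at x within D1)" if x: "x \<in> D1" and y: "y \<in> D2" and l: "l \<noteq> 0" for x y l
  proof -
    have eq: "U s y l = UY y l ** P s y (of_real l)" if "s \<in> D1" for s
      by (simp add: U_eq[OF that y l] P(2)[OF that y l])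
    have "((\<lambda>s. UY y l ** P s y (of_real l)) has_vector_derivative
        UY y l ** (P x y (of_real l) ** ((\<i> / 2) *m mat2 (- of_real (px x y)) (of_real l) (of_real l) (of_real (px x y)))))
        (at x within D1)"
      by (rule bounded_linear.has_vector_derivative[OF cmm.bounded_linear_right px[OF x y]])
    from has_vector_derivative_transform[OF x eq this] show ?thesis
      by (simp add: eq[OF x] cscale_mult_right matrix_mul_assoc)
  qed
  have Uy: "((\<lambda>t. U x t l) has_vector_derivative
      (- \<i> / (2 * of_real l)) *m (U x y l ** mat2 0 (exp (\<i> * of_real (\<phi> x y))) (exp (- \<i> * of_real (\<phi> x y))) 0))
      (at y within D2)" if x: "x \<in> D1" and y: "y \<in> D2" and l: "l \<noteq> 0" for x y l
  proof -
    have eq: "U x t l = UX x l ** V0 x ** Q x t (1 / of_real l)" if "t \<in> D2" for t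
      by (simp add: assms(16) Q(2)[OF x that l])
    have "((\<lambda>t. UX x l ** V0 x ** Q x t (1 / of_real l)) has_vector_derivative
        UX x l ** V0 x ** (Q x y (1 / of_real l) ** ((1 / of_real l) *m (adj2 (P x y 0) ** N y ** P x y 0))))
        (at y within D2)"
      by (rule bounded_linear.has_vector_derivative[OF cmm.bounded_linear_right Qy[OF x y]])
    moreover have "(1 / of_real l) *m (adj2 (P x y 0) ** N y ** P x y 0) =
        (- \<i> / (2 * of_real l)) *m mat2 0 (exp (\<i> * of_real (\<phi> x y))) (exp (- \<i> * of_real (\<phi> x y))) 0"
    proof -
      have a: "P x y 0 $ 1 $ 1 = exp (- \<i> * of_real (\<psi> y x) / 2)" "P x y 0 $ 2 $ 2 = exp (\<i> * of_real (\<psi> y x) / 2)"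
        using \<psi>(1)[OF x y] P(6)[OF x y] by (simp_all add: exp_cnj)
      \<comment> \<open>Conjugation of \<open>N y\<close> by the diagonal matrix
        \<open>P x y 0\<close> multiplies its off-diagonal entries by
        \<open>exp (\<i> * \<psi>)\<close> and its inverse; this is why \<psi> and \<beta> add up to
        \<phi>.\<close>
      have "exp (\<i> * of_real (\<phi> x y)) = exp (\<i> * of_real (\<psi> y x) / 2) * exp (\<i> * of_real (\<beta> y)) * exp (\<i> * of_real (\<psi> y x) / 2)"
        "exp (- \<i> * of_real (\<phi> x y)) = exp (- \<i> * of_real (\<psi> y x) / 2) * exp (- \<i> * of_real (\<beta> y)) * exp (- \<i> * of_real (\<psi> y x) / 2)"
        unfolding exp_add[symmetric] by (simp_all add: \<phi>_def algebra_simps)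
      then show ?thesis
        using a P(4,5)[OF x y] by (simp add: cmat_eq_iff N_def mult_ac)
    qed
    ultimately have "((\<lambda>t. UX x l ** V0 x ** Q x t (1 / of_real l)) has_vector_derivative
        UX x l ** V0 x ** (Q x y (1 / of_real l) ** ((- \<i> / (2 * of_real l)) *m
          mat2 0 (exp (\<i> * of_real (\<phi> x y))) (exp (- \<i> * of_real (\<phi> x y))) 0))) (at y within D2)"
      by simp
    from has_vector_derivative_transform[OF y eq this] show ?thesis
      by (simp add: eq[OF y] cscale_mult_right matrix_mul_assoc)
  qed
  have \<phi>x: "((\<lambda>s. \<phi> s y) has_real_derivative px x y) (at x within D1)" if "x \<in> D1" "y \<in> D2" for x y
    using DERIV_add[OF \<psi>(2)[OF that] DERIV_const[of "\<beta> y"]] by (simp add: \<phi>_def)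
  have "\<phi> x 0 = \<alpha> x + \<beta> 0" "\<phi> 0 y = \<beta> y" if "y \<in> D2" for x y
    using \<psi>(3)[OF that] by (simp_all add: \<phi>_def \<psi>(4))
  then have "(\<forall>x\<in>D1. \<phi> x 0 = \<alpha> x + \<beta> 0) \<and> (\<forall>y\<in>D2. \<phi> 0 y = \<beta> y)"
    using assms(4) by blast
  then show ?thesis
    using U_eq U00 Ux Uy \<phi>x by blast
qed

end
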